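(* For $M>0$ let $g^M(y,u)=\min\{g(y,u),M\}$. Assume that there exist $M_1$ and a bounded set $D\subset G$ such that for all $M\ge M_1$, all $\alpha\in(0,1)$ and all positive integers $S$, optimal processes in the problems $$\min_{y_0\in Y,\,u(\cdot)\in\mathcal{U}(y_0)}\sum_{t=0}^\infty\alpha^t g^M(y(t),u(t))\quad\text{and}\quad \min_{y_0\in Y,\,u(\cdot)\in\mathcal{U}_S(y_0)}\sum_{t=0}^{S-1}g^M(y(t),u(t))$$ (minimization being over both the control and the initial condition) exist and all of them remain in $D$. Then the limits $\lim_{\alpha\to1^-}\min_{y\in Y}V_\alpha(y)$ and $\lim_{S\to\infty}\min_{y\in Y}V(S,y)$ exist and $$g^*=\lim_{\alpha\to1^-}\min_{y\in Y}V_\alpha(y)=\lim_{S\to\infty}\min_{y\in Y}V(S,y).$$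
   Context: System. $Y\subset\mathbb{R}^m$ is a nonempty closed unbounded set, $U_0$ is a compact metric space, $U(\cdot):Y\leadsto U_0$ is an upper semicontinuous compact-valued set-valued map, $f:\mathbb{R}^m\times U_0\to\mathbb{R}^m$ is continuous, and $|f(y,u)|\to\infty$ as $|y|\to\infty$ uniformly in $u$. Consider the discrete-time system $y(t+1)=f(y(t),u(t))$, $t=0,1,\dots$, $y(0)=y_0$, $y(t)\in Y$, $u(t)\in U(y(t))$. Let $G=\{(y,u): y\in Y,\ u\in U(y),\ f(y,u)\in Y\}$. A control $u(\cdot)$ and the pair $(y(\cdot),u(\cdot))$ are called admissible if these relations hold; an admissible process satisfies $(y(t),u(t))\in G$ for all $t$ under consideration. $\mathcal{U}(y_0)$ is the set of admissible controls on the infinite horizon, and $\mathcal{U}_S(y_0)$ the set of admissible controls on $\{0,\dots,S-1\}$ ($S$ a positive integer), for the initial condition $y_0$. It is assumed that $\mathcal{U}(y_0)\ne\emptyset$ for all $y_0\in Y$. Cost. $g:\mathbb{R}^m\times U_0\to\mathbb{R}$ is continuous and bounded below (possibly unbounded above). For $\alpha\in(0,1)$, $$V_\alpha(y_0)=(1-\alpha)\inf_{u(\cdot)\in\mathcal{U}(y_0)}\sum_{t=0}^\infty\alpha^t g(y(t),u(t)),\qquad V(S,y_0)=\frac1S\min_{u(\cdot)\in\mathcal{U}_S(y_0)}\sum_{t=0}^{S-1}g(y(t),u(t)).$$ $\bar Y=Y\cup\{\infty_Y\}$ is the one-point compactification of $Y$; $\varphi\in C(\bar Y)$ means that $\varphi$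 is continuous and real-valued on $Y$ with a finite limit as $|y|\to\infty$. $\mathcal{P}(G)$ is the set of Borel probability measures on $G$, $$W=\Big\{\gamma\in\mathcal{P}(G): \int_G(\varphi(f(y,u))-\varphi(y))\,d\gamma=0\ \ \forall\varphi\in C(\bar Y)\Big\},\qquad g^*=\inf_{\gamma\in W}\int_G g(y,u)\,d\gamma .$$ *)

theory Defs
  imports "HOL-Probability.Probability"
begin

definition usc_on :: "'a::topological_space set \<Rightarrow> ('a \<Rightarrow> 'u::topological_space set) \<Rightarrow> bool" where
  "usc_on Y U \<longleftrightarrow>
     (\<forall>y\<in>Y. \<forall>V. open V \<and> U y \<subseteq> V \<longrightarrow> (\<forall>\<^sub>F z in at y within Y. U z \<subseteq> V))"

definition graph_set :: "'a set \<Rightarrow> ('a \<Rightarrow> 'u set) \<Rightarrow> ('a \<times> 'u \<Rightarrow> 'a) \<Rightarrow> ('a \<times> 'u) set" where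
  "graph_set Y U f = {(y, u). y \<in> Y \<and> u \<in> U y \<and> f (y, u) \<in> Y}"

text \<open>The trajectory generated by an initial state and a control; a process is thus represented
  by the pair of its initial state and its control.\<close>

primrec traj :: "('a \<times> 'u \<Rightarrow> 'a) \<Rightarrow> 'a \<Rightarrow> (nat \<Rightarrow> 'u) \<Rightarrow> nat \<Rightarrow> 'a" where
  "traj f y0 u 0 = y0"
| "traj f y0 u (Suc t) = f (traj f y0 u t, u t)"

definition adm ::
  "'a set \<Rightarrow> ('a \<Rightarrow> 'u set) \<Rightarrow> ('a \<times> 'u \<Rightarrow> 'a) \<Rightarrow> 'a \<Rightarrow> (nat \<Rightarrow> 'u) set" where
  "adm Y U f y0 = {u. \<forall>t. (traj f y0 u t, u t) \<in> graph_set Y U f}"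

text \<open>On the horizon \<open>{0..<S}\<close> only the values \<open>u t\<close> with \<open>t < S\<close> are constrained, and only those
  enter the cost. Membership in the graph at time \<open>S - 1\<close> forces the terminal state into \<open>Y\<close>.\<close>

definition adm_fin ::
  "'a set \<Rightarrow> ('a \<Rightarrow> 'u set) \<Rightarrow> ('a \<times> 'u \<Rightarrow> 'a) \<Rightarrow> nat \<Rightarrow> 'a \<Rightarrow> (nat \<Rightarrow> 'u) set" where
  "adm_fin Y U f S y0 = {u. \<forall>t<S. (traj f y0 u t, u t) \<in> graph_set Y U f}"

text \<open>The running cost is bounded below but possibly unbounded above, so for \<open>0 < \<alpha> < 1\<close> the series
  converges in the extended reals, possibly to \<open>\<infinity>\<close>.\<close>

definition disc_cost ::
  "('a \<times> 'u \<Rightarrow> 'a) \<Rightarrow> ('a \<times> 'u \<Rightarrow> real) \<Rightarrow> real \<Rightarrow> 'a \<Rightarrow> (nat \<Rightarrow> 'u) \<Rightarrow> ereal" where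
  "disc_cost f g \<alpha> y0 u = (\<Sum>t. ereal (\<alpha> ^ t * g (traj f y0 u t, u t)))"

definition fin_cost ::
  "('a \<times> 'u \<Rightarrow> 'a) \<Rightarrow> ('a \<times> 'u \<Rightarrow> real) \<Rightarrow> nat \<Rightarrow> 'a \<Rightarrow> (nat \<Rightarrow> 'u) \<Rightarrow> real" where
  "fin_cost f g S y0 u = (\<Sum>t<S. g (traj f y0 u t, u t))"

definition V_disc ::
  "'a set \<Rightarrow> ('a \<Rightarrow> 'u set) \<Rightarrow> ('a \<times> 'u \<Rightarrow> 'a) \<Rightarrow> ('a \<times> 'u \<Rightarrow> real) \<Rightarrow> real \<Rightarrow> 'a \<Rightarrow> ereal" where
  "V_disc Y U f g \<alpha> y0 = ereal (1 - \<alpha>) * (INF u\<in>adm Y U f y0. disc_cost f g \<alpha> y0 u)"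

text \<open>For \<open>y0 \<in> Y\<close> and \<open>S > 0\<close> the set of costs is nonempty and bounded below under the standing
  assumptions, so the real infimum is the genuine one; it is a minimum by compactness.\<close>

definition V_fin ::
  "'a set \<Rightarrow> ('a \<Rightarrow> 'u set) \<Rightarrow> ('a \<times> 'u \<Rightarrow> 'a) \<Rightarrow> ('a \<times> 'u \<Rightarrow> real) \<Rightarrow> nat \<Rightarrow> 'a \<Rightarrow> real" where
  "V_fin Y U f g S y0 = 1 / real S * (INF u\<in>adm_fin Y U f S y0. fin_cost f g S y0 u)"

definition optimal_disc ::
  "'a set \<Rightarrow> ('a \<Rightarrow> 'u set) \<Rightarrow> ('a \<times> 'u \<Rightarrow> 'a) \<Rightarrow> ('a \<times> 'u \<Rightarrow> real) \<Rightarrow> real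
     \<Rightarrow> 'a \<Rightarrow> (nat \<Rightarrow> 'u) \<Rightarrow> bool" where
  "optimal_disc Y U f g \<alpha> y0 u \<longleftrightarrow>
     y0 \<in> Y \<and> u \<in> adm Y U f y0 \<and>
     (\<forall>z0\<in>Y. \<forall>v\<in>adm Y U f z0. disc_cost f g \<alpha> y0 u \<le> disc_cost f g \<alpha> z0 v)"

definition optimal_fin ::
  "'a set \<Rightarrow> ('a \<Rightarrow> 'u set) \<Rightarrow> ('a \<times> 'u \<Rightarrow> 'a) \<Rightarrow> ('a \<times> 'u \<Rightarrow> real) \<Rightarrow> nat
     \<Rightarrow> 'a \<Rightarrow> (nat \<Rightarrow> 'u) \<Rightarrow> bool" where
  "optimal_fin Y U f g S y0 u \<longleftrightarrow>
     y0 \<in> Y \<and> u \<in> adm_fin Y U f S y0 \<and>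
     (\<forall>z0\<in>Y. \<forall>v\<in>adm_fin Y U f S z0. fin_cost f g S y0 u \<le> fin_cost f g S z0 v)"

definition truncate_cost :: "('a \<Rightarrow> real) \<Rightarrow> real \<Rightarrow> 'a \<Rightarrow> real" where
  "truncate_cost g M p = min (g p) M"

text \<open>Continuous functions on the one-point compactification of \<open>Y\<close>, described by their
  restrictions to \<open>Y\<close>.\<close>

definition C_compactified :: "'a::real_normed_vector set \<Rightarrow> ('a \<Rightarrow> real) set" where
  "C_compactified Y =
     {\<phi>. continuous_on Y \<phi> \<and> (\<exists>l. (\<phi> \<longlongrightarrow> l) (inf at_infinity (principal Y)))}"

definition W_set ::
  "'a::real_normed_vector set \<Rightarrow> ('a \<Rightarrow> 'u::topological_space set) \<Rightarrow> ('a \<times> 'u \<Rightarrow> 'a)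
     \<Rightarrow> ('a \<times> 'u) measure set" where
  "W_set Y U f =
     {\<gamma>. prob_space \<gamma> \<and> sets \<gamma> = sets (restrict_space borel (graph_set Y U f)) \<and>
         (\<forall>\<phi>\<in>C_compactified Y. (\<integral>p. \<phi> (f p) - \<phi> (fst p) \<partial>\<gamma>) = 0)}"

text \<open>The Lebesgue integral of a function with integrable negative part, as an extended real. The
  Bochner integral is unsuitable for an unbounded cost: it is \<open>0\<close> on nonintegrable functions.\<close>

definition ext_integral :: "'b measure \<Rightarrow> ('b \<Rightarrow> real) \<Rightarrow> ereal" where
  "ext_integral M h =
     enn2ereal (\<integral>\<^sup>+ x. ennreal (h x) \<partial>M) - enn2ereal (\<integral>\<^sup>+ x. ennreal (- h x) \<partial>M)"

definition g_star ::
  "'a::real_normed_vector set \<Rightarrow> ('a \<Rightarrow> 'u::topological_space set) \<Rightarrow> ('a \<times> 'u \<Rightarrow> 'a)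
     \<Rightarrow> ('a \<times> 'u \<Rightarrow> real) \<Rightarrow> ereal" where
  "g_star Y U f g = (INF \<gamma>\<in>W_set Y U f. ext_integral \<gamma> g)"

end

theory Submission
  imports Defs
begin

text \<open>
  Why the theorem holds. Fix a compact part \<open>K\<close> of the graph containing \<open>D\<close> and an upper bound \<open>M\<close>
  of \<open>g\<close> on \<open>K\<close>. A process that is optimal for the truncated cost \<open>h = min g M\<close> stays in \<open>D\<close>,
  where \<open>h = g\<close>; as \<open>h \<le> g\<close> everywhere, it is also optimal for \<open>g\<close>
  (\<open>optimal_disc_of_truncated\<close>, \<open>optimal_fin_of_truncated\<close>). So both optimal values are attained,
  and they are values of a problem with a bounded cost. They are compared with \<open>g\<^sup>*\<close> in two steps.

  No optimal value exceeds \<open>g\<^sup>*\<close>. Let \<open>X\<^sub>k\<close> be the optimal cost of \<open>k\<close> steps, given by the dynamic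
  programming recursion. Then \<open>X\<^sub>k\<^sub>+\<^sub>1 (y) \<le> h (y, u) + \<alpha> X\<^sub>k (f (y, u))\<close> on the graph. A measure
  \<open>\<gamma> \<in> W\<close> gives \<open>f\<close> and the first projection the same distribution (\<open>W_marginals_eq\<close>), hence
  \<open>\<integral>X\<^sub>k\<^sub>+\<^sub>1 d\<gamma> \<le> \<integral>h d\<gamma> + \<alpha> \<integral>X\<^sub>k d\<gamma>\<close>, and by induction
  \<open>\<integral>X\<^sub>k d\<gamma> \<le> (1 + \<alpha> + \<dots> + \<alpha>\<^sup>k\<^sup>-\<^sup>1) \<integral>h d\<gamma>\<close>. With \<open>\<alpha> = 1\<close> this bounds the averages over finite horizons;
  with \<open>\<alpha> < 1\<close> and \<open>k \<rightarrow> \<infinity>\<close> it bounds the discounted values. The integrals make sense because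
  \<open>X\<^sub>k\<close> is lower semicontinuous: \<open>U0\<close> is compact and the graph is closed.

  No limit of optimal values along \<open>S \<rightarrow> \<infinity>\<close> or \<open>\<alpha> \<rightarrow> 1\<close> lies below \<open>g\<^sup>*\<close>. An optimal value is the
  integral of \<open>g\<close> against the occupation measure of an optimal process: the uniform distribution of
  its first \<open>S\<close> points, or the geometric distribution with parameter \<open>1 - \<alpha>\<close> of all its
  points. These measures live on \<open>K\<close>
  and violate the equations that define \<open>W\<close> only by \<open>O(1/S)\<close> or \<open>O(1 - \<alpha>)\<close>
  (\<open>occupation_fin_almost_invariant\<close>, \<open>occupation_disc_almost_invariant\<close>), so their weak limits are
  in \<open>W\<close> (\<open>almost_invariant_family_imp_W\<close>).

  Weak compactness of probability measures on \<open>K\<close> is reduced to Helly's selection theorem on the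
  real line. By a variant of the Hausdorff--Alexandroff theorem, \<open>K\<close> is the image of a compact set of
  reals under a continuous map \<open>q\<close> (\<open>compact_metric_continuous_image_of_real_set\<close>): the measures are
  lifted to the line along a right inverse of \<open>q\<close>, which may be discontinuous, a convergent
  subsequence is selected there, and its limit is pushed down along \<open>q\<close>.
\<close>

section \<open>Coding a compact metric space by real numbers\<close>

text \<open>
  Binary digits in base three, as in the Cantor set but without its factor two: the gaps that make
  decoding continuous are still there.
\<close>

definition ternary_code :: "(nat \<Rightarrow> bool) \<Rightarrow> real" where
  "ternary_code d = (\<Sum>i. of_bool (d i) / 3 ^ i)"

lemma ternary_code_summable: "summable (\<lambda>i. of_bool (d i) / 3 ^ i :: real)"
proof (rule summable_comparison_test')
  show "summable (\<lambda>i. (1 / 3) ^ i :: real)"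
    by (rule summable_geometric) simp
  show "norm (of_bool (d n) / 3 ^ n :: real) \<le> (1 / 3) ^ n" for n
    by (simp add: power_one_over)
qed

lemma ternary_code_bounds: "0 \<le> ternary_code d" "ternary_code d \<le> 3 / 2"
proof -
  show "0 \<le> ternary_code d"
    unfolding ternary_code_def by (intro suminf_nonneg ternary_code_summable) simp
  have "ternary_code d \<le> (\<Sum>i. (1 / 3) ^ i)"
    unfolding ternary_code_def
    by (intro suminf_le ternary_code_summable summable_geometric) (simp_all add: power_one_over)
  then show "ternary_code d \<le> 3 / 2"
    by (simp add: suminf_geometric)
qed

lemma ternary_code_shift: "ternary_code d = of_bool (d 0) + ternary_code (\<lambda>i. d (Suc i)) / 3"
proof -
  have "ternary_code d = (\<Sum>i. of_bool (d (Suc i)) / 3 ^ Suc i) + of_bool (d 0)"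
    unfolding ternary_code_def
    using suminf_split_head[OF ternary_code_summable[of d]] by simp
  also have "(\<Sum>i. of_bool (d (Suc i)) / 3 ^ Suc i :: real) = (\<Sum>i. of_bool (d (Suc i)) / 3 ^ i) / 3"
    using suminf_divide[OF ternary_code_summable[of "\<lambda>i. d (Suc i)"], of 3] by (simp add: field_simps)
  finally show ?thesis
    by (simp add: ternary_code_def)
qed

text \<open>
  The digits after the first contribute at most \<open>(3/2) / 3 = 1/2\<close>, so different first digits keep the
  codes at least \<open>1/2\<close> apart. Shifting multiplies the distance by three, which gives the
  statement about later digits.
\<close>

lemma ternary_code_close_imp_head_eq:
  assumes "\<bar>ternary_code d - ternary_code d'\<bar> < 1 / 2"
  shows "d 0 = d' 0"
  using assms ternary_code_shift[of d] ternary_code_shift[of d']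
    ternary_code_bounds[of "\<lambda>i. d (Suc i)"] ternary_code_bounds[of "\<lambda>i. d' (Suc i)"]
  by (cases "d 0"; cases "d' 0") (auto simp: abs_if split: if_splits)

lemma ternary_code_close_imp_digits_eq:
  assumes "\<bar>ternary_code d - ternary_code d'\<bar> < 1 / (2 * 3 ^ n)" and "i \<le> n"
  shows "d i = d' i"
  using assms
proof (induction i arbitrary: d d' n)
  case 0
  have "(1::real) / (2 * 3 ^ n) \<le> 1 / 2"
    by (simp add: field_simps)
  with 0 show ?case
    by (intro ternary_code_close_imp_head_eq) linarith
next
  case (Suc i)
  from Suc.prems obtain m where m: "n = Suc m" "i \<le> m"
    by (cases n) auto
  have "(1::real) / (2 * 3 ^ n) \<le> 1 / 2"
    by (simp add: field_simps)
  with Suc.prems have "d 0 = d' 0"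
    by (intro ternary_code_close_imp_head_eq) linarith
  then have "\<bar>ternary_code (\<lambda>i. d (Suc i)) - ternary_code (\<lambda>i. d' (Suc i))\<bar>
      = 3 * \<bar>ternary_code d - ternary_code d'\<bar>"
    unfolding ternary_code_shift[of d] ternary_code_shift[of d'] by (simp add: abs_if)
  also have "\<dots> < 1 / (2 * 3 ^ m)"
    using Suc.prems(1) m(1) by (simp add: field_simps)
  finally show ?case
    using Suc.IH m(2) by blast
qed

text \<open>
  List the balls of finite nets of radius \<open>1, 1/2, 1/3, \<dots>\<close>. Finitely many positions in the list
  suffice for each precision because each net is finite.
\<close>

lemma compact_countable_fine_cover:
  fixes K :: "'a::metric_space set"
  assumes "compact K"
  shows "\<exists>B :: nat \<Rightarrow> 'a set.
    \<forall>\<epsilon>>0. \<exists>n. \<forall>x\<in>K. \<exists>i\<le>n. x \<in> B i \<and> (\<forall>y\<in>B i. \<forall>z\<in>B i. dist y z < \<epsilon>)"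
proof -
  have "\<exists>F. finite F \<and> K \<subseteq> (\<Union>x\<in>F. ball x (1 / Suc k))" for k
    using seq_compact_imp_totally_bounded[OF compact_imp_seq_compact[OF assms]]
    by (meson of_nat_0_less_iff zero_less_Suc zero_less_divide_1_iff)
  then obtain F where F: "\<And>k. finite (F k)" "\<And>k. K \<subseteq> (\<Union>x\<in>F k. ball x (1 / Suc k))"
    by metis
  define \<B> where "\<B> = insert {} (\<Union>k. (\<lambda>x. ball x (1 / Suc k)) ` F k)"
  have cnt: "countable \<B>"
    unfolding \<B>_def using F(1)
    by (intro countable_insert countable_UN countableI_type countable_finite finite_imageI)
  show ?thesis
  proof (intro exI[of _ "from_nat_into \<B>"] allI impI)
    fix \<epsilon> :: real
    assume "0 < \<epsilon>"
    then obtain k where k: "1 / Suc k < \<epsilon> / 2"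
      by (metis half_gt_zero nat_approx_posE)
    define n where "n = Max (insert 0 (to_nat_on \<B> ` (\<lambda>x. ball x (1 / Suc k)) ` F k))"
    have "\<exists>i\<le>n. x \<in> from_nat_into \<B> i \<and> (\<forall>y\<in>from_nat_into \<B> i. \<forall>z\<in>from_nat_into \<B> i. dist y z < \<epsilon>)"
      if "x \<in> K" for x
    proof -
      from that F(2)[of k] obtain c where c: "c \<in> F k" "x \<in> ball c (1 / Suc k)"
        by auto
      let ?b = "ball c (1 / Suc k)"
      have "?b \<in> \<B>"
        using c(1) by (auto simp: \<B>_def)
      then have eq: "from_nat_into \<B> (to_nat_on \<B> ?b) = ?b"
        using cnt by simp
      have "to_nat_on \<B> ?b \<le> n"
        unfolding n_def using F(1) c(1) by (intro Max_ge) auto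
      moreover have "dist y z < \<epsilon>" if "y \<in> ?b" "z \<in> ?b" for y z
        using that k dist_triangle_half_l[of c y \<epsilon> z] dist_triangle3[of y z c]
        by (auto simp: dist_commute)
      ultimately show ?thesis
        using eq c(2) by metis
    qed
    then show "\<exists>n. \<forall>x\<in>K. \<exists>i\<le>n. x \<in> from_nat_into \<B> i \<and>
        (\<forall>y\<in>from_nat_into \<B> i. \<forall>z\<in>from_nat_into \<B> i. dist y z < \<epsilon>)"
      by blast
  qed
qed

text \<open>
  The digits of \<open>x\<close> record which sets of a fine cover contain \<open>x\<close>. Close codes have equal initial
  digits, so their points share a small set of the cover. The code itself is discontinuous, but its
  inverse is uniformly continuous.
\<close>

lemma compact_real_code:
  fixes K :: "'a::metric_space set"
  assumes "compact K"
  shows "\<exists>h :: 'a \<Rightarrow> real. (\<forall>x. h x \<in> {0..3/2}) \<and>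
    (\<forall>\<epsilon>>0. \<exists>\<delta>>0. \<forall>x\<in>K. \<forall>y\<in>K. \<bar>h x - h y\<bar> < \<delta> \<longrightarrow> dist x y < \<epsilon>)"
proof -
  obtain B :: "nat \<Rightarrow> 'a set"
    where B: "\<And>\<epsilon>. 0 < \<epsilon> \<Longrightarrow> \<exists>n. \<forall>x\<in>K. \<exists>i\<le>n. x \<in> B i \<and> (\<forall>y\<in>B i. \<forall>z\<in>B i. dist y z < \<epsilon>)"
    using compact_countable_fine_cover[OF assms] by blast
  define h where "h x = ternary_code (\<lambda>i. x \<in> B i)" for x
  show ?thesis
  proof (intro exI[of _ h] conjI allI impI)
    show "h x \<in> {0..3/2}" for x
      using ternary_code_bounds by (simp add: h_def)
    fix \<epsilon> :: real
    assume "0 < \<epsilon>"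
    from B[OF this] obtain n where
      n: "\<forall>x\<in>K. \<exists>i\<le>n. x \<in> B i \<and> (\<forall>y\<in>B i. \<forall>z\<in>B i. dist y z < \<epsilon>)" ..
    have "dist x y < \<epsilon>" if xy: "x \<in> K" "y \<in> K" "\<bar>h x - h y\<bar> < 1 / (2 * 3 ^ n)" for x y
    proof -
      from bspec[OF n xy(1)] obtain i
        where i: "i \<le> n" "x \<in> B i" "\<forall>y\<in>B i. \<forall>z\<in>B i. dist y z < \<epsilon>"
        by auto
      have "y \<in> B i"
        using ternary_code_close_imp_digits_eq[OF xy(3)[unfolded h_def] i(1)] i(2) by simp
      with i(2,3) show ?thesis by simp
    qed
    moreover have "0 < (1::real) / (2 * 3 ^ n)"
      by simp
    ultimately show "\<exists>\<delta>>0. \<forall>x\<in>K. \<forall>y\<in>K. \<bar>h x - h y\<bar> < \<delta> \<longrightarrow> dist x y < \<epsilon>"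
      by blast
  qed
qed

text \<open>
  The uniformly continuous inverse of the code extends to the closure of the set of codes. As the
  ambient type need not be complete, the extension is built by hand, with its values in \<open>K\<close>.
\<close>

lemma compact_metric_continuous_image_of_real_set:
  fixes K :: "'a::metric_space set"
  assumes "compact K"
  shows "\<exists>(C :: real set) (q :: real \<Rightarrow> 'a) (h :: 'a \<Rightarrow> real).
    compact C \<and> continuous_on C q \<and> q ` C \<subseteq> K \<and> (\<forall>x\<in>K. h x \<in> C \<and> q (h x) = x)"
proof -
  obtain h :: "'a \<Rightarrow> real"
    where h01: "\<And>x. h x \<in> {0..3/2}"
      and h: "\<And>\<epsilon>. 0 < \<epsilon> \<Longrightarrow> \<exists>\<delta>>0. \<forall>x\<in>K. \<forall>y\<in>K. \<bar>h x - h y\<bar> < \<delta> \<longrightarrow> dist x y < \<epsilon>"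
    using compact_real_code[OF assms] by blast
  define C where "C = closure (h ` K)"
  have "compact C"
  proof -
    have "h ` K \<subseteq> {0..3/2}"
      using h01 by blast
    then have "bounded (h ` K)"
      using bounded_closed_interval bounded_subset by blast
    then show ?thesis
      by (simp add: C_def compact_closure)
  qed
  \<comment> \<open>\<open>lim s x\<close> says that \<open>x\<close> is the limit in \<open>K\<close> of all points whose codes approach \<open>s\<close>.\<close>
  define lim where
    "lim s x \<longleftrightarrow> x \<in> K \<and> (\<forall>\<epsilon>>0. \<exists>\<delta>>0. \<forall>y\<in>K. \<bar>h y - s\<bar> < \<delta> \<longrightarrow> dist x y < \<epsilon>)" for s x
  have lim_exists: "\<forall>s\<in>C. \<exists>x. lim s x"
  proof
    fix s
    assume "s \<in> C"
    then obtain z where z: "\<And>n. z n \<in> h ` K" "z \<longlonglongrightarrow> s"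
      unfolding C_def closure_sequential by auto
    have "\<forall>n. \<exists>x. x \<in> K \<and> z n = h x"
      using z(1) by blast
    then obtain x where x: "\<And>n. x n \<in> K" "\<And>n. z n = h (x n)"
      by metis
    obtain l r where l: "l \<in> K" "strict_mono r" "(x \<circ> r) \<longlonglongrightarrow> l"
      using assms x(1) unfolding compact_def by blast
    have hl: "(\<lambda>n. h (x (r n))) \<longlonglongrightarrow> s"
      using LIMSEQ_subseq_LIMSEQ[OF z(2) l(2)] by (simp add: o_def x(2))
    have "\<exists>\<delta>>0. \<forall>y\<in>K. \<bar>h y - s\<bar> < \<delta> \<longrightarrow> dist l y < \<epsilon>" if "0 < \<epsilon>" for \<epsilon>
    proof -
      from h[of "\<epsilon> / 2"] that obtain \<delta> where
        \<delta>: "\<delta> > 0" "\<forall>x\<in>K. \<forall>y\<in>K. \<bar>h x - h y\<bar> < \<delta> \<longrightarrow> dist x y < \<epsilon> / 2"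
        by auto
      have "dist l y < \<epsilon>" if y: "y \<in> K" "\<bar>h y - s\<bar> < \<delta>" for y
      proof -
        have "((\<lambda>n. \<bar>h (x (r n)) - h y\<bar>) \<longlongrightarrow> \<bar>s - h y\<bar>) sequentially"
          by (intro tendsto_intros hl)
        then have "\<forall>\<^sub>F n in sequentially. \<bar>h (x (r n)) - h y\<bar> < \<delta>"
          using y(2) by (intro order_tendstoD) (auto simp: abs_minus_commute)
        then have "\<forall>\<^sub>F n in sequentially. dist (x (r n)) y \<le> \<epsilon> / 2"
          by eventually_elim (use \<delta>(2) x(1) y(1) in force)
        moreover have "(\<lambda>n. dist (x (r n)) y) \<longlonglongrightarrow> dist l y"
          using l(3) by (intro tendsto_intros) (simp add: o_def)
        ultimately have "dist l y \<le> \<epsilon> / 2"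
          by (intro tendsto_upperbound) auto
        with \<open>0 < \<epsilon>\<close> show ?thesis by simp
      qed
      with \<delta>(1) show ?thesis by blast
    qed
    with l(1) show "\<exists>x. lim s x"
      by (auto simp: lim_def)
  qed
  obtain q where q: "\<And>s. s \<in> C \<Longrightarrow> lim s (q s)"
    using bchoice[OF lim_exists] by blast
  have qK: "q s \<in> K" if "s \<in> C" for s
    using q[OF that] unfolding lim_def by (rule conjunct1)
  have q_close: "\<exists>\<delta>>0. \<forall>y\<in>K. \<bar>h y - s\<bar> < \<delta> \<longrightarrow> dist (q s) y < \<epsilon>" if "s \<in> C" "0 < \<epsilon>" for s \<epsilon>
    using conjunct2[OF q[OF that(1), unfolded lim_def]] that(2) by simp
  have hC: "h x \<in> C" if "x \<in> K" for x
    unfolding C_def using that by (intro set_mp[OF closure_subset] imageI)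
  show ?thesis
  proof (intro exI[of _ C] exI[of _ q] exI[of _ h] conjI ballI \<open>compact C\<close> hC)
    show "q ` C \<subseteq> K"
      using qK by (rule image_subsetI)
    show "q (h x) = x" if "x \<in> K" for x
    proof -
      have "dist (q (h x)) x < \<epsilon>" if "0 < \<epsilon>" for \<epsilon>
        using q_close[OF hC[OF \<open>x \<in> K\<close>] that] \<open>x \<in> K\<close> by force
      then show ?thesis
        by (meson dist_pos_lt less_irrefl)
    qed
    show "continuous_on C q"
      unfolding continuous_on_iff
    proof (intro ballI allI impI)
      fix s and \<epsilon> :: real
      assume s: "s \<in> C" and "0 < \<epsilon>"
      then obtain \<delta> where \<delta>: "\<delta> > 0" "\<forall>y\<in>K. \<bar>h y - s\<bar> < \<delta> \<longrightarrow> dist (q s) y < \<epsilon> / 2"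
        using q_close[OF s, of "\<epsilon> / 2"] by auto
      have "dist (q t) (q s) < \<epsilon>" if t: "t \<in> C" "dist t s < \<delta> / 2" for t
      proof -
        obtain \<eta> where \<eta>: "\<eta> > 0" "\<forall>y\<in>K. \<bar>h y - t\<bar> < \<eta> \<longrightarrow> dist (q t) y < \<epsilon> / 2"
          using q_close[OF t(1), of "\<epsilon> / 2"] \<open>0 < \<epsilon>\<close> by auto
        have "0 < min \<eta> (\<delta> / 2)"
          using \<eta>(1) \<delta>(1) by simp
        then obtain y where y: "y \<in> K" "dist (h y) t < min \<eta> (\<delta> / 2)"
          using t(1) unfolding C_def closure_approachable by blast
        then have "\<bar>h y - t\<bar> < \<eta>" "\<bar>h y - s\<bar> < \<delta>"
          using t(2) unfolding dist_real_def by linarith+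
        then have "dist (q t) y < \<epsilon> / 2" "dist (q s) y < \<epsilon> / 2"
          using bspec[OF \<eta>(2) y(1)] bspec[OF \<delta>(2) y(1)] by simp_all
        then show ?thesis
          using dist_triangle2[of "q t" "q s" y] by simp
      qed
      then show "\<exists>d>0. \<forall>t\<in>C. dist t s < d \<longrightarrow> dist (q t) (q s) < \<epsilon>"
        using \<delta>(1) by (intro exI[of _ "\<delta> / 2"]) auto
    qed
  qed
qed

section \<open>Weak limits of discrete distributions on a compact set\<close>

text \<open>
  Sequential weak compactness of probability measures on a compact metric space, for measures given as
  images of discrete distributions. The limit is delivered as the distribution of a Borel map
  \<open>q\<close> on a probability space over the reals. Discrete distributions make the code of \<open>K\<close>
  measurable for free; only \<open>q\<close> has to be Borel.
\<close>

lemma pmf_family_on_compact_has_limit: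
  fixes K :: "'a::metric_space set" and p :: "nat \<Rightarrow> 'i pmf" and x :: "nat \<Rightarrow> 'i \<Rightarrow> 'a"
  assumes "compact K" and xK: "\<And>n i. i \<in> set_pmf (p n) \<Longrightarrow> x n i \<in> K"
  shows "\<exists>r \<mu> q. strict_mono r \<and> prob_space \<mu> \<and> sets \<mu> = sets (borel :: real measure) \<and>
    q \<in> borel_measurable borel \<and> range q \<subseteq> K \<and>
    (\<forall>F :: 'a \<Rightarrow> real. continuous_on K F \<longrightarrow>
      (\<lambda>n. \<integral>i. F (x (r n) i) \<partial>measure_pmf (p (r n))) \<longlonglongrightarrow> (\<integral>s. F (q s) \<partial>\<mu>))"
proof -
  obtain C :: "real set" and q :: "real \<Rightarrow> 'a" and h :: "'a \<Rightarrow> real"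
    where C: "compact C" "continuous_on C q" "q ` C \<subseteq> K"
      and hC: "\<And>x. x \<in> K \<Longrightarrow> h x \<in> C" and qh: "\<And>x. x \<in> K \<Longrightarrow> q (h x) = x"
    using compact_metric_continuous_image_of_real_set[OF assms(1)] by metis
  obtain i0 where "i0 \<in> set_pmf (p 0)"
    using set_pmf_not_empty by fastforce
  then have k0: "x 0 i0 \<in> K"
    by (rule xK)
  let ?k0 = "x 0 i0"
  have "C \<noteq> {}"
    using hC k0 by blast
  have closedC: "closed C"
    using C(1) by (rule compact_imp_closed)
  define \<nu> where "\<nu> n = distr (measure_pmf (p n)) borel (\<lambda>i. h (x n i))" for n
  have int_\<nu>: "(\<integral>s. \<psi> s \<partial>\<nu> n) = (\<integral>i. \<psi> (h (x n i)) \<partial>measure_pmf (p n))"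
    if "continuous_on UNIV \<psi>" for \<psi> :: "real \<Rightarrow> real" and n
    unfolding \<nu>_def using that by (intro integral_distr) (auto intro: borel_measurable_continuous_onI)
  have "tight \<nu>"
    unfolding tight_def
  proof (intro conjI allI impI)
    show "real_distribution (\<nu> n)" for n
      unfolding \<nu>_def by (intro prob_space.real_distribution_distr measure_pmf.prob_space_axioms) simp
    obtain b where b: "\<And>s. s \<in> C \<Longrightarrow> \<bar>s\<bar> \<le> b"
      using compact_imp_bounded[OF C(1)] unfolding bounded_real by blast
    have "measure (\<nu> n) {- b - 1<..b} = 1" for n
    proof -
      have "AE i in measure_pmf (p n). i \<in> (\<lambda>i. h (x n i)) -` {- b - 1<..b}"
        unfolding AE_measure_pmf_iff using b[OF hC[OF xK]] by (fastforce simp: abs_le_iff)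
      then show ?thesis
        unfolding \<nu>_def by (subst measure_distr) (auto simp: measure_pmf.prob_eq_1)
    qed
    moreover have "- b - 1 < b"
      using b \<open>C \<noteq> {}\<close> by force
    ultimately show "\<exists>a b. a < b \<and> (\<forall>n. 1 - \<epsilon> < measure (\<nu> n) {a<..b})" if "0 < \<epsilon>" for \<epsilon> :: real
      using that by (intro exI[of _ "- b - 1"] exI[of _ b]) simp
  qed
  from tight_imp_convergent_subsubsequence[OF this strict_mono_id]
  obtain r \<mu> where r: "strict_mono r" and \<mu>: "real_distribution \<mu>" and conv: "weak_conv_m (\<nu> \<circ> id \<circ> r) \<mu>"
    by blast
  interpret \<mu>: real_distribution \<mu> by fact
  have conv_int: "(\<lambda>n. \<integral>i. \<psi> (h (x (r n) i)) \<partial>measure_pmf (p (r n))) \<longlonglongrightarrow> (\<integral>s. \<psi> s \<partial>\<mu>)"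
    if \<psi>: "continuous_on UNIV \<psi>" "\<And>s. \<bar>\<psi> s\<bar> \<le> b" for \<psi> :: "real \<Rightarrow> real" and b
  proof -
    have "(\<lambda>n. \<integral>s. \<psi> s \<partial>((\<nu> \<circ> id \<circ> r) n)) \<longlonglongrightarrow> (\<integral>s. \<psi> s \<partial>\<mu>)"
    proof (rule weak_conv_imp_integral_bdd_continuous_conv[OF _ \<mu> conv])
      show "real_distribution ((\<nu> \<circ> id \<circ> r) n)" for n
        unfolding \<nu>_def o_def
        by (intro prob_space.real_distribution_distr measure_pmf.prob_space_axioms) simp
      show "isCont \<psi> s" for s
        using \<psi>(1) by (simp add: continuous_on_eq_continuous_at)
      show "norm (\<psi> s) \<le> b" for s
        using \<psi>(2) by simp
    qed
    then show ?thesis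
      by (simp add: int_\<nu>[OF \<psi>(1)])
  qed
  \<comment> \<open>The truncated distance from \<open>C\<close> is a bounded continuous test function that all lifted measures annihilate.\<close>
  have AE_C: "AE s in \<mu>. s \<in> C"
  proof -
    let ?\<psi> = "\<lambda>s. min 1 (infdist s C)"
    have cont: "continuous_on UNIV ?\<psi>"
      by (intro continuous_intros)
    have "(\<integral>i. ?\<psi> (h (x n i)) \<partial>measure_pmf (p n)) = 0" for n
    proof -
      have "(\<integral>i. ?\<psi> (h (x n i)) \<partial>measure_pmf (p n)) = (\<integral>i. 0 \<partial>measure_pmf (p n))"
        by (intro integral_cong_AE) (auto simp: AE_measure_pmf_iff hC xK)
      then show ?thesis by simp
    qed
    then have "(\<integral>s. ?\<psi> s \<partial>\<mu>) = 0"
      using conv_int[OF cont, of 1] by (simp add: infdist_nonneg LIMSEQ_const_iff)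
    moreover have "integrable \<mu> ?\<psi>"
      using borel_measurable_continuous_onI[OF cont]
      by (intro \<mu>.integrable_const_bound[of _ 1]) (auto simp: infdist_nonneg)
    ultimately have "AE s in \<mu>. ?\<psi> s = 0"
      by (subst (asm) integral_nonneg_eq_0_iff_AE) (auto simp: infdist_nonneg)
    then show ?thesis
      by eventually_elim
        (use in_closed_iff_infdist_zero[OF closedC \<open>C \<noteq> {}\<close>] in \<open>auto simp: min_def split: if_splits\<close>)
  qed
  \<comment> \<open>Off the null set \<open>- C\<close> any point of \<open>K\<close> serves as a default value.\<close>
  define q' where "q' s = (if s \<in> C then q s else ?k0)" for s
  have q'_meas: "q' \<in> borel_measurable borel"
    unfolding q'_def
    by (subst measurable_If_restrict_space_iff)
      (use closedC C(2) in \<open>auto intro!: borel_measurable_continuous_on_restrict\<close>)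
  have q'K: "range q' \<subseteq> K"
    using C(3) k0 by (auto simp: q'_def)
  have "(\<lambda>n. \<integral>i. F (x (r n) i) \<partial>measure_pmf (p (r n))) \<longlonglongrightarrow> (\<integral>s. F (q' s) \<partial>\<mu>)"
    if F: "continuous_on K F" for F :: "'a \<Rightarrow> real"
  proof -
    have FqC: "continuous_on C (\<lambda>s. F (q s))"
      using continuous_on_compose2[OF F C(2)] C(3) by blast
    obtain b where b: "\<And>s. s \<in> C \<Longrightarrow> \<bar>F (q s)\<bar> \<le> b"
      using compact_imp_bounded[OF compact_continuous_image[OF FqC C(1)]] unfolding bounded_real by blast
    have "0 \<le> b"
      using b \<open>C \<noteq> {}\<close> by force
    have "closedin (top_of_set UNIV) C"
      using closedC by simp
    \<comment> \<open>Weak convergence tests continuous functions on the whole line, so \<open>F \<circ> q\<close> is extended from \<open>C\<close>.\<close>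
    from Tietze[OF FqC this \<open>0 \<le> b\<close>] b
    obtain \<psi> where \<psi>: "continuous_on UNIV \<psi>" "\<And>s. s \<in> C \<Longrightarrow> \<psi> s = F (q s)" "\<And>s. \<bar>\<psi> s\<bar> \<le> b"
      by auto
    have "(\<integral>i. \<psi> (h (x n i)) \<partial>measure_pmf (p n)) = (\<integral>i. F (x n i) \<partial>measure_pmf (p n))" for n
      by (intro integral_cong_AE) (auto simp: AE_measure_pmf_iff hC xK \<psi>(2) qh)
    moreover have "(\<integral>s. \<psi> s \<partial>\<mu>) = (\<integral>s. F (q' s) \<partial>\<mu>)"
    proof (rule integral_cong_AE)
      show "\<psi> \<in> borel_measurable \<mu>"
        using borel_measurable_continuous_onI[OF \<psi>(1)] by simp
      have "(\<lambda>s. if s \<in> C then F (q s) else F ?k0) \<in> borel_measurable borel"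
        by (subst measurable_If_restrict_space_iff)
          (use closedC FqC in \<open>auto intro!: borel_measurable_continuous_on_restrict\<close>)
      then show "(\<lambda>s. F (q' s)) \<in> borel_measurable \<mu>"
        by (simp add: q'_def if_distrib[of F] cong: if_cong)
      show "AE s in \<mu>. \<psi> s = F (q' s)"
        using AE_C by eventually_elim (simp add: q'_def \<psi>(2))
    qed
    ultimately show ?thesis
      using conv_int[OF \<psi>(1) \<psi>(3)] by simp
  qed
  then show ?thesis
    using r \<mu>.prob_space_axioms q'_meas q'K
    by (intro exI[of _ r] exI[of _ \<mu>] exI[of _ q']) simp
qed

section \<open>The control system and its stationary measures\<close>

text \<open>
  \<open>case_nat u v\<close> is the control that applies \<open>u\<close> first and then follows \<open>v\<close>.
\<close>

lemma traj_case_nat_Suc: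
  "traj f y (case_nat u v) (Suc t) = traj f (f (y, u)) v t"
  by (induction t) auto

text \<open>
  Value iteration for the problem with \<open>k\<close> steps and discount factor \<open>\<alpha>\<close>. The recursion splits off
  the first step, so that semicontinuity can be carried along by induction with one
  minimization at a time. The real infimum is the genuine one when \<open>h\<close> is bounded on the graph
  and each \<open>y\<close> has an admissible control value.
\<close>

primrec dp_value ::
  "('a \<times> 'u) set \<Rightarrow> ('a \<times> 'u \<Rightarrow> 'a) \<Rightarrow> ('a \<times> 'u \<Rightarrow> real) \<Rightarrow> real \<Rightarrow> nat \<Rightarrow> 'a \<Rightarrow> real" where
  "dp_value G f h \<alpha> 0 y = 0"
| "dp_value G f h \<alpha> (Suc k) y = (INF u\<in>{u. (y, u) \<in> G}. h (y, u) + \<alpha> * dp_value G f h \<alpha> k (f (y, u)))"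

locale control_system =
  fixes Y :: "'a::euclidean_space set"
    and U0 :: "'u::metric_space set"
    and U :: "'a \<Rightarrow> 'u set"
    and f :: "'a \<times> 'u \<Rightarrow> 'a"
  assumes Y_closed: "closed Y"
    and U0_compact: "compact U0"
    and U_values: "\<forall>y\<in>Y. U y \<subseteq> U0 \<and> compact (U y)"
    and U_usc: "usc_on Y U"
    and f_cont: "continuous_on (UNIV \<times> U0) f"
    and viable: "\<forall>y\<in>Y. adm Y U f y \<noteq> {}"
begin

abbreviation "G \<equiv> graph_set Y U f"

lemma graph_subset: "G \<subseteq> Y \<times> U0"
  using U_values by (auto simp: graph_set_def)

lemma graph_into: "p \<in> G \<Longrightarrow> f p \<in> Y"
  by (auto simp: graph_set_def)

lemma graph_fst: "p \<in> G \<Longrightarrow> fst p \<in> Y"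
  by (auto simp: graph_set_def)

lemma graph_section_nonempty:
  assumes "y \<in> Y"
  shows "\<exists>u. (y, u) \<in> G"
proof -
  obtain u where "u \<in> adm Y U f y"
    using viable assms by blast
  then have "(traj f y u 0, u 0) \<in> G"
    unfolding adm_def by blast
  then show ?thesis by auto
qed

lemma graph_cont:
  assumes "continuous_on (UNIV \<times> U0) F"
  shows "continuous_on G F"
  using assms graph_subset by (elim continuous_on_subset) auto

text \<open>
  A closed graph theorem: an upper semicontinuous map with closed values has a closed graph, because
  otherwise a neighbourhood of \<open>U y'\<close> could be separated from the limit \<open>u'\<close>. The constraint
  that \<open>f\<close> stays in \<open>Y\<close> is closed by continuity.
\<close>

lemma graph_limit:
  assumes yu: "\<And>n. (y n, u n) \<in> G" and y: "y \<longlonglongrightarrow> y'" and u: "u \<longlonglongrightarrow> u'"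
  shows "(y', u') \<in> G"
proof -
  have yY: "y n \<in> Y" and uU: "u n \<in> U (y n)" and u0: "u n \<in> U0" and fY: "f (y n, u n) \<in> Y" for n
    using yu[of n] U_values by (auto simp: graph_set_def)
  have y'Y: "y' \<in> Y"
    using Y_closed yY y by (rule closed_sequentially)
  have u'0: "u' \<in> U0"
    using compact_imp_closed[OF U0_compact] u0 u by (rule closed_sequentially)
  have "(\<lambda>n. (y n, u n)) \<longlonglongrightarrow> (y', u')"
    using y u by (rule tendsto_Pair)
  then have "(\<lambda>n. f (y n, u n)) \<longlonglongrightarrow> f (y', u')"
    using u'0 u0 by (intro continuous_on_tendsto_compose[OF f_cont]) auto
  with Y_closed fY have "f (y', u') \<in> Y"
    by (rule closed_sequentially)
  moreover have "u' \<in> U y'"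
  proof (rule ccontr)
    assume "u' \<notin> U y'"
    moreover have "closed (U y')"
      using U_values y'Y compact_imp_closed by blast
    ultimately obtain e where e: "e > 0" "ball u' e \<subseteq> - U y'"
      using openE[of "- U y'" u'] by (metis ComplI open_Compl)
    \<comment> \<open>The complement of a ball around \<open>u'\<close> is a neighbourhood of \<open>U y'\<close> that eventually misses \<open>u n\<close>.\<close>
    let ?V = "- cball u' (e / 2)"
    have UV: "U y' \<subseteq> ?V"
    proof
      fix v
      assume "v \<in> U y'"
      then have "e \<le> dist u' v"
        using e(2) by (force simp: not_less[symmetric])
      then show "v \<in> ?V"
        using e(1) by simp
    qed
    then have "\<forall>\<^sub>F z in at y' within Y. U z \<subseteq> ?V"
      using U_usc y'Y unfolding usc_on_def by (auto simp: open_Compl)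
    then obtain d where d: "d > 0" "\<And>z. z \<in> Y \<Longrightarrow> z \<noteq> y' \<Longrightarrow> dist z y' < d \<Longrightarrow> U z \<subseteq> ?V"
      unfolding eventually_at by auto
    have "\<forall>\<^sub>F n in sequentially. dist (y n) y' < d" "\<forall>\<^sub>F n in sequentially. dist (u n) u' < e / 2"
      using tendstoD[OF y d(1)] tendstoD[OF u half_gt_zero[OF e(1)]] by simp_all
    then have "\<forall>\<^sub>F n in sequentially. False"
    proof eventually_elim
      case (elim n)
      then have "U (y n) \<subseteq> ?V"
        using d(2)[OF yY] UV by metis
      then have "u n \<in> ?V"
        using uU by blast
      with elim show False
        by (simp add: dist_commute)
    qed
    then show False by simp
  qed
  ultimately show ?thesis
    using y'Y by (simp add: graph_set_def)
qed

lemma graph_closed: "closed G"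
  unfolding closed_sequential_limits
proof (intro allI impI, elim conjE)
  fix z l
  assume z: "\<forall>n. z n \<in> G" "z \<longlonglongrightarrow> l"
  have "(fst l, snd l) \<in> G"
  proof (rule graph_limit)
    show "(fst (z n), snd (z n)) \<in> G" for n
      using z(1) by simp
    show "(\<lambda>n. fst (z n)) \<longlonglongrightarrow> fst l" "(\<lambda>n. snd (z n)) \<longlonglongrightarrow> snd l"
      by (intro tendsto_intros z(2))+
  qed
  then show "l \<in> G" by simp
qed

lemma W_setD:
  assumes "\<gamma> \<in> W_set Y U f"
  shows "prob_space \<gamma>" "sets \<gamma> = sets (restrict_space borel G)" "space \<gamma> = G"
    "\<And>\<phi>. \<phi> \<in> C_compactified Y \<Longrightarrow> (\<integral>p. \<phi> (f p) - \<phi> (fst p) \<partial>\<gamma>) = 0"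
proof -
  show "prob_space \<gamma>" and sets: "sets \<gamma> = sets (restrict_space borel G)"
    and "\<And>\<phi>. \<phi> \<in> C_compactified Y \<Longrightarrow> (\<integral>p. \<phi> (f p) - \<phi> (fst p) \<partial>\<gamma>) = 0"
    using assms by (auto simp: W_set_def)
  show "space \<gamma> = G"
    using sets_eq_imp_space_eq[OF sets] by (simp add: space_restrict_space)
qed

lemma W_measurable_cont:
  assumes "\<gamma> \<in> W_set Y U f" and "continuous_on G F"
  shows "F \<in> borel_measurable \<gamma>"
  using borel_measurable_continuous_on_restrict[OF assms(2)] W_setD(2)[OF assms(1)]
  by (simp cong: measurable_cong_sets)

lemma W_measurable_fst: "\<gamma> \<in> W_set Y U f \<Longrightarrow> fst \<in> borel_measurable \<gamma>"
  by (rule W_measurable_cont) (auto intro: continuous_intros)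

lemma W_measurable_f: "\<gamma> \<in> W_set Y U f \<Longrightarrow> f \<in> borel_measurable \<gamma>"
  by (rule W_measurable_cont) (auto intro: graph_cont f_cont)

text \<open>
  The test functions in the definition of \<open>W\<close> determine finite Borel measures: the indicator of a
  bounded open set is an increasing limit of continuous functions that vanish outside that set, and
  bounded boxes generate the Borel sets. Stationarity thereby extends from continuous to Borel
  functions, in particular to semicontinuous value functions.
\<close>

lemma W_marginals_eq:
  assumes \<gamma>: "\<gamma> \<in> W_set Y U f"
  shows "distr \<gamma> borel f = distr \<gamma> borel fst"
proof -
  interpret prob_space \<gamma>
    using W_setD(1)[OF \<gamma>] .
  note [measurable] = W_measurable_fst[OF \<gamma>] W_measurable_f[OF \<gamma>]
  have eq: "emeasure (distr \<gamma> borel f) Q = emeasure (distr \<gamma> borel fst) Q"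
    if Q: "open Q" "bounded Q" for Q :: "'a set"
  proof -
    have O_meas [measurable]: "Q \<in> sets borel"
      using Q(1) by simp
    have "- Q \<noteq> {}"
      using Q(2) not_bounded_UNIV by (metis Compl_empty_eq double_complement)
    have closed: "closed (- Q)"
      using Q(1) by (rule closed_Compl)
    \<comment> \<open>These functions increase to the indicator of \<open>Q\<close>.\<close>
    define \<phi> where "\<phi> n y = min 1 (real n * infdist y (- Q))" for n y
    have \<phi>_cont: "continuous_on UNIV (\<phi> n)" for n
      unfolding \<phi>_def by (intro continuous_intros)
    have [measurable]: "\<phi> n \<in> borel_measurable borel" for n
      using \<phi>_cont by (rule borel_measurable_continuous_onI)
    have \<phi>_bound: "\<bar>\<phi> n y\<bar> \<le> 1" for n y
      by (simp add: \<phi>_def infdist_nonneg)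
    have \<phi>_out: "\<phi> n y = 0" if "y \<notin> Q" for n y
      using that by (simp add: \<phi>_def)
    have "\<phi> n \<in> C_compactified Y" for n
    proof -
      obtain b where b: "\<And>y. y \<in> Q \<Longrightarrow> norm y \<le> b"
        using Q(2) unfolding bounded_iff by blast
      have "\<forall>\<^sub>F y in at_infinity. \<phi> n y = 0"
        unfolding eventually_at_infinity
      proof (intro exI[of _ "b + 1"] allI impI)
        fix y :: 'a
        assume "b + 1 \<le> norm y"
        then have "y \<notin> Q"
          using b by force
        then show "\<phi> n y = 0"
          by (rule \<phi>_out)
      qed
      then have "(\<phi> n \<longlongrightarrow> 0) at_infinity"
        by (rule tendsto_eventually)
      then have "(\<phi> n \<longlongrightarrow> 0) (inf at_infinity (principal Y))"
        by (rule tendsto_mono[OF inf_le1])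
      then show ?thesis
        unfolding C_compactified_def using continuous_on_subset[OF \<phi>_cont] by auto
    qed
    from W_setD(4)[OF \<gamma> this]
    have int_eq: "(\<integral>p. \<phi> n (f p) \<partial>\<gamma>) = (\<integral>p. \<phi> n (fst p) \<partial>\<gamma>)" for n
      using \<phi>_bound by (subst (asm) Bochner_Integration.integral_diff)
        (auto intro!: integrable_const_bound[of _ 1])
    have \<phi>_lim: "(\<lambda>n. \<phi> n y) \<longlonglongrightarrow> indicat_real Q y" for y
    proof (cases "y \<in> Q")
      case True
      then have pos: "0 < infdist y (- Q)"
        using in_closed_iff_infdist_zero[OF closed \<open>- Q \<noteq> {}\<close>, of y] infdist_nonneg[of y "- Q"] by auto
      obtain N :: nat where N: "1 / infdist y (- Q) < real N"
        using reals_Archimedean2 by blast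
      have "\<phi> n y = 1" if "n \<ge> N" for n
      proof -
        have "1 / infdist y (- Q) < real n"
          using N that by linarith
        then have "1 < real n * infdist y (- Q)"
          using pos by (simp add: field_simps)
        then show ?thesis
          by (simp add: \<phi>_def)
      qed
      then have "\<forall>\<^sub>F n in sequentially. \<phi> n y = 1"
        unfolding eventually_sequentially by blast
      then show ?thesis
        using True by (simp add: tendsto_eventually)
    next
      case False
      then show ?thesis
        by (simp add: \<phi>_out)
    qed
    have lim: "(\<lambda>n. \<integral>p. \<phi> n (k p) \<partial>\<gamma>) \<longlonglongrightarrow> measure (distr \<gamma> borel k) Q"
      if [measurable]: "k \<in> borel_measurable \<gamma>" for k
    proof -
      have "(\<lambda>n. \<integral>p. \<phi> n (k p) \<partial>\<gamma>) \<longlonglongrightarrow> (\<integral>p. indicat_real Q (k p) \<partial>\<gamma>)"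
        using \<phi>_lim \<phi>_bound by (intro integral_dominated_convergence[where w = "\<lambda>_. 1"]) auto
      also have "(\<integral>p. indicat_real Q (k p) \<partial>\<gamma>) = (\<integral>y. indicat_real Q y \<partial>(distr \<gamma> borel k))"
        by (rule integral_distr[symmetric]) auto
      also have "\<dots> = measure (distr \<gamma> borel k) Q"
        by simp
      finally show ?thesis .
    qed
    have "measure (distr \<gamma> borel f) Q = measure (distr \<gamma> borel fst) Q"
      using lim[of f] lim[of fst] unfolding int_eq by (auto intro: LIMSEQ_unique)
    then show ?thesis
      using W_measurable_f[OF \<gamma>] W_measurable_fst[OF \<gamma>]
      by (simp add: finite_measure.emeasure_eq_measure[OF finite_measure_distr])
  qed
  let ?E = "range (\<lambda>(a, b). box a b :: 'a set)"
  have fin: "emeasure (distr \<gamma> borel f) X \<noteq> \<infinity>" for X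
    using finite_measure.emeasure_finite[OF finite_measure_distr[OF W_measurable_f[OF \<gamma>]]] by simp
  show ?thesis
  proof (rule measure_eqI_generator_eq[where E = ?E and \<Omega> = UNIV
        and A = "\<lambda>n::nat. box (- (real n *\<^sub>R One)) (real n *\<^sub>R One) :: 'a set"])
    show "Int_stable ?E"
      by (auto simp: Int_stable_def box_Int_box)
    show "emeasure (distr \<gamma> borel f) X = emeasure (distr \<gamma> borel fst) X" if "X \<in> ?E" for X
      using that eq[OF open_box bounded_box] by force
    show "sets (distr \<gamma> borel f) = sigma_sets UNIV ?E" "sets (distr \<gamma> borel fst) = sigma_sets UNIV ?E"
      by (simp_all add: borel_eq_box)
    show "(\<Union>n::nat. box (- (real n *\<^sub>R One)) (real n *\<^sub>R One)) = (UNIV :: 'a set)"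
      by (rule UN_box_eq_UNIV)
    show "emeasure (distr \<gamma> borel f) (box (- (real n *\<^sub>R One)) (real n *\<^sub>R One)) \<noteq> \<infinity>" for n :: nat
      by (rule fin)
  qed auto
qed

lemma W_integral_invariant:
  assumes \<gamma>: "\<gamma> \<in> W_set Y U f" and X: "X \<in> borel_measurable (restrict_space borel Y)"
  shows "(\<integral>p. X (f p) \<partial>\<gamma>) = (\<integral>p. (X (fst p) :: real) \<partial>\<gamma>)"
proof -
  define X' where "X' y = indicator Y y * X y" for y
  have [measurable]: "X' \<in> borel_measurable borel"
    unfolding X'_def using X Y_closed
    by (subst (asm) borel_measurable_restrict_space_iff) (auto simp: mult.commute)
  have "(\<integral>p. X (f p) \<partial>\<gamma>) = (\<integral>p. X' (f p) \<partial>\<gamma>)"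
    using W_setD(3)[OF \<gamma>] graph_into
    by (intro Bochner_Integration.integral_cong) (auto simp: X'_def)
  also have "\<dots> = (\<integral>y. X' y \<partial>(distr \<gamma> borel f))"
    by (intro integral_distr[symmetric] W_measurable_f \<gamma>) simp
  also have "\<dots> = (\<integral>y. X' y \<partial>(distr \<gamma> borel fst))"
    by (simp only: W_marginals_eq[OF \<gamma>])
  also have "\<dots> = (\<integral>p. X' (fst p) \<partial>\<gamma>)"
    by (intro integral_distr W_measurable_fst \<gamma>) simp
  also have "\<dots> = (\<integral>p. X (fst p) \<partial>\<gamma>)"
    using W_setD(3)[OF \<gamma>] graph_fst
    by (intro Bochner_Integration.integral_cong) (auto simp: X'_def)
  finally show ?thesis .
qed

end

text \<open>
  A bounded set need not be relatively compact in a product with a general metric space; here the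
  second factor is compact and the graph is closed.
\<close>

lemma (in control_system) bounded_in_compact_graph:
  assumes "D \<subseteq> G" "bounded D"
  shows "\<exists>K. compact K \<and> K \<subseteq> G \<and> D \<subseteq> K"
proof -
  obtain R where R: "\<And>p. p \<in> D \<Longrightarrow> norm (fst p) \<le> R"
    using bounded_fst[OF assms(2)] unfolding bounded_iff by auto
  let ?K = "G \<inter> (cball 0 R \<times> U0)"
  have "compact ?K"
    using graph_closed by (intro closed_Int_compact compact_Times U0_compact) auto
  moreover have "D \<subseteq> ?K"
  proof
    fix p
    assume p: "p \<in> D"
    with assms(1) graph_subset have "p \<in> G" "snd p \<in> U0"
      by auto
    with R[OF p] show "p \<in> ?K"
      by (cases p) auto
  qed
  ultimately show ?thesis by blast
qed

section \<open>Value iteration bounds stationary costs from below\<close>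

context control_system
begin

abbreviation "val \<equiv> dp_value G f"

lemma dp_value_Suc_le:
  assumes "(y, u) \<in> G" and lower: "\<And>v. (y, v) \<in> G \<Longrightarrow> b \<le> h (y, v) + \<alpha> * val h \<alpha> k (f (y, v))"
  shows "val h \<alpha> (Suc k) y \<le> h (y, u) + \<alpha> * val h \<alpha> k (f (y, u))"
  unfolding dp_value.simps using assms by (intro cINF_lower bdd_belowI2[of _ b]) auto

lemma dp_value_bounded:
  assumes h: "\<forall>p\<in>G. \<bar>h p\<bar> \<le> B" and \<alpha>: "0 \<le> \<alpha>" "\<alpha> \<le> 1" and "y \<in> Y"
  shows "\<bar>val h \<alpha> k y\<bar> \<le> real k * B"
  using \<open>y \<in> Y\<close>
proof (induction k arbitrary: y)
  case (Suc k)
  have step: "\<bar>h (y, u) + \<alpha> * val h \<alpha> k (f (y, u))\<bar> \<le> real (Suc k) * B" if "(y, u) \<in> G" for u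
  proof -
    have "\<bar>\<alpha> * val h \<alpha> k (f (y, u))\<bar> \<le> 1 * \<bar>val h \<alpha> k (f (y, u))\<bar>"
      unfolding abs_mult using \<alpha> by (intro mult_right_mono) auto
    moreover have "\<bar>val h \<alpha> k (f (y, u))\<bar> \<le> real k * B"
      by (rule Suc.IH[OF graph_into[OF that]])
    ultimately show ?thesis
      using bspec[OF h that] by (simp add: algebra_simps)
  qed
  obtain u where u: "(y, u) \<in> G"
    using graph_section_nonempty[OF Suc.prems] by blast
  have "val h \<alpha> (Suc k) y \<le> h (y, u) + \<alpha> * val h \<alpha> k (f (y, u))"
    using step by (intro dp_value_Suc_le[OF u, of "- (real (Suc k) * B)"]) (simp only: abs_le_iff minus_le_iff)
  moreover have "- (real (Suc k) * B) \<le> val h \<alpha> (Suc k) y"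
    unfolding dp_value.simps
    using step u by (intro cINF_greatest) (auto simp only: abs_le_iff minus_le_iff mem_Collect_eq)
  ultimately show ?case
    using step[OF u] by (simp only: abs_le_iff) linarith
qed simp

lemma dp_value_le:
  assumes h: "\<forall>p\<in>G. \<bar>h p\<bar> \<le> B" and \<alpha>: "0 \<le> \<alpha>" "\<alpha> \<le> 1" and u: "(y, u) \<in> G"
  shows "val h \<alpha> (Suc k) y \<le> h (y, u) + \<alpha> * val h \<alpha> k (f (y, u))"
proof (rule dp_value_Suc_le[OF u])
  fix v
  assume v: "(y, v) \<in> G"
  have "\<bar>\<alpha> * val h \<alpha> k (f (y, v))\<bar> \<le> 1 * \<bar>val h \<alpha> k (f (y, v))\<bar>"
    unfolding abs_mult using \<alpha> by (intro mult_right_mono) auto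
  then show "- B - real k * B \<le> h (y, v) + \<alpha> * val h \<alpha> k (f (y, v))"
    using bspec[OF h v] dp_value_bounded[OF h \<alpha> graph_into[OF v], of k] by linarith
qed

lemma dp_value_near_optimal:
  assumes y: "y \<in> Y" and less: "val h \<alpha> (Suc k) y < a"
  obtains u where "(y, u) \<in> G" "h (y, u) + \<alpha> * val h \<alpha> k (f (y, u)) < a"
proof -
  have "(\<lambda>u. h (y, u) + \<alpha> * val h \<alpha> k (f (y, u))) ` {u. (y, u) \<in> G} \<noteq> {}"
    using graph_section_nonempty[OF y] by blast
  from cInf_lessD[OF this less[unfolded dp_value.simps]] show thesis
    using that by blast
qed

text \<open>
  An \<open>\<epsilon>\<close>-optimal control is assembled by concatenating an \<open>\<epsilon>/2\<close>-optimal first step with an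
  \<open>\<epsilon>/2\<close>-optimal continuation.
\<close>

lemma dp_value_achieved:
  assumes "0 \<le> \<alpha>" "\<alpha> \<le> 1" "y \<in> Y" and "0 < \<epsilon>"
  shows "\<exists>u\<in>adm_fin Y U f k y. (\<Sum>t<k. \<alpha> ^ t * h (traj f y u t, u t)) < val h \<alpha> k y + \<epsilon>"
  using \<open>y \<in> Y\<close> \<open>0 < \<epsilon>\<close>
proof (induction k arbitrary: y \<epsilon>)
  case 0
  then show ?case
    by (auto simp: adm_fin_def)
next
  case (Suc k)
  have "val h \<alpha> (Suc k) y < val h \<alpha> (Suc k) y + \<epsilon> / 2"
    using Suc.prems by simp
  from dp_value_near_optimal[OF Suc.prems(1) this] obtain u where
    u: "(y, u) \<in> G" "h (y, u) + \<alpha> * val h \<alpha> k (f (y, u)) < val h \<alpha> (Suc k) y + \<epsilon> / 2" .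
  from Suc.IH[OF graph_into[OF u(1)], of "\<epsilon> / 2"] Suc.prems obtain v where
    v: "v \<in> adm_fin Y U f k (f (y, u))"
      "(\<Sum>t<k. \<alpha> ^ t * h (traj f (f (y, u)) v t, v t)) < val h \<alpha> k (f (y, u)) + \<epsilon> / 2"
    by auto
  let ?w = "case_nat u v"
  have "?w \<in> adm_fin Y U f (Suc k) y"
    unfolding adm_fin_def
  proof (intro CollectI allI impI)
    fix t
    assume "t < Suc k"
    then show "(traj f y ?w t, ?w t) \<in> G"
      using u(1) v(1) unfolding adm_fin_def
      by (cases t) (simp_all add: traj_case_nat_Suc del: traj.simps(2))
  qed
  moreover have "(\<Sum>t<Suc k. \<alpha> ^ t * h (traj f y ?w t, ?w t)) < val h \<alpha> (Suc k) y + \<epsilon>"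
  proof -
    have "(\<Sum>t<Suc k. \<alpha> ^ t * h (traj f y ?w t, ?w t))
        = h (y, u) + \<alpha> * (\<Sum>t<k. \<alpha> ^ t * h (traj f (f (y, u)) v t, v t))"
      unfolding sum.lessThan_Suc_shift sum_distrib_left
      by (simp add: traj_case_nat_Suc mult.assoc del: traj.simps(2) sum.lessThan_Suc)
    also have "\<dots> \<le> h (y, u) + \<alpha> * (val h \<alpha> k (f (y, u)) + \<epsilon> / 2)"
      using v(2) assms(1) by (intro add_left_mono mult_left_mono) auto
    also have "\<dots> \<le> h (y, u) + \<alpha> * val h \<alpha> k (f (y, u)) + \<epsilon> / 2"
      using mult_right_mono[OF assms(2), of "\<epsilon> / 2"] Suc.prems(2) by (simp add: algebra_simps)
    finally show ?thesis
      using u(2) by simp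
  qed
  ultimately show ?case by blast
qed

text \<open>
  Lower semicontinuity of the value function, phrased as closedness of its epigraph: the varying bound
  \<open>s n\<close> absorbs the continuous summand \<open>h\<close> and the errors of near-optimal choices, so the
  induction needs no separate rule for sums. Near-optimal control values \<open>u n\<close> at \<open>y n\<close> have a limit
  point by compactness of \<open>U0\<close>, and it is admissible at \<open>y'\<close> because the graph is closed.
\<close>

lemma dp_value_epigraph_closed:
  assumes h: "\<forall>p\<in>G. \<bar>h p\<bar> \<le> B" and h_cont: "continuous_on G h"
    and \<alpha>: "0 < \<alpha>" "\<alpha> \<le> 1"
    and "\<And>n. y n \<in> Y" "y \<longlonglongrightarrow> y'" "s \<longlonglongrightarrow> s'" "\<And>n. val h \<alpha> k (y n) \<le> s n"
  shows "val h \<alpha> k y' \<le> s'"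
  using assms(5-)
proof (induction k arbitrary: y y' s s')
  case 0
  then show ?case
    by (auto intro: LIMSEQ_le_const)
next
  case (Suc k)
  have "\<exists>u. (y n, u) \<in> G \<and> h (y n, u) + \<alpha> * val h \<alpha> k (f (y n, u)) < s n + 1 / Suc n" for n
  proof -
    have "val h \<alpha> (Suc k) (y n) < s n + 1 / Suc n"
      using Suc.prems(4)[of n] by (rule le_less_trans) simp
    from dp_value_near_optimal[OF Suc.prems(1) this] show ?thesis
      by blast
  qed
  then obtain u where u: "\<And>n. (y n, u n) \<in> G"
    "\<And>n. h (y n, u n) + \<alpha> * val h \<alpha> k (f (y n, u n)) < s n + 1 / Suc n"
    by metis
  have "u n \<in> U0" for n
    using u(1)[of n] graph_subset by blast
  then obtain u' r where r: "strict_mono r" "(u \<circ> r) \<longlonglongrightarrow> u'"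
    using U0_compact unfolding compact_def by blast
  have yr: "(\<lambda>n. y (r n)) \<longlonglongrightarrow> y'" and sr: "(\<lambda>n. s (r n)) \<longlonglongrightarrow> s'"
    and ur: "(\<lambda>n. u (r n)) \<longlonglongrightarrow> u'"
    using LIMSEQ_subseq_LIMSEQ[OF _ r(1)] Suc.prems(2,3) r(2) by (auto simp: o_def)
  have inv: "(\<lambda>n. 1 / real (Suc (r n))) \<longlonglongrightarrow> 0"
    using LIMSEQ_subseq_LIMSEQ[OF LIMSEQ_Suc[OF lim_1_over_n] r(1)] by (simp add: o_def)
  have yu': "(y', u') \<in> G"
    using u(1) yr ur by (rule graph_limit)
  have yur: "(\<lambda>n. (y (r n), u (r n))) \<longlonglongrightarrow> (y', u')"
    using yr ur by (rule tendsto_Pair)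
  have hr: "(\<lambda>n. h (y (r n), u (r n))) \<longlonglongrightarrow> h (y', u')"
    using u(1) yu' by (intro continuous_on_tendsto_compose[OF h_cont yur]) auto
  have fr: "(\<lambda>n. f (y (r n), u (r n))) \<longlonglongrightarrow> f (y', u')"
    using u(1) yu' by (intro continuous_on_tendsto_compose[OF graph_cont[OF f_cont] yur]) auto
  have "val h \<alpha> k (f (y', u')) \<le> (s' + 0 - h (y', u')) / \<alpha>"
  proof (rule Suc.IH)
    show "f (y (r n), u (r n)) \<in> Y" for n
      by (rule graph_into[OF u(1)])
    show "(\<lambda>n. f (y (r n), u (r n))) \<longlonglongrightarrow> f (y', u')"
      by (rule fr)
    show "(\<lambda>n. (s (r n) + 1 / real (Suc (r n)) - h (y (r n), u (r n))) / \<alpha>)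
        \<longlonglongrightarrow> (s' + 0 - h (y', u')) / \<alpha>"
      using \<alpha>(1) by (intro tendsto_divide tendsto_diff tendsto_add sr hr inv tendsto_const) auto
    show "val h \<alpha> k (f (y (r n), u (r n)))
        \<le> (s (r n) + 1 / real (Suc (r n)) - h (y (r n), u (r n))) / \<alpha>" for n
      unfolding pos_le_divide_eq[OF \<alpha>(1)] using u(2)[of "r n"] by (simp add: mult.commute)
  qed
  then have "h (y', u') + \<alpha> * val h \<alpha> k (f (y', u')) \<le> s'"
    unfolding pos_le_divide_eq[OF \<alpha>(1)] by (simp add: mult.commute)
  moreover have "val h \<alpha> (Suc k) y' \<le> h (y', u') + \<alpha> * val h \<alpha> k (f (y', u'))"
    using \<alpha> by (intro dp_value_le[OF h _ _ yu']) auto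
  ultimately show ?case by linarith
qed

lemma dp_value_measurable:
  assumes h: "\<forall>p\<in>G. \<bar>h p\<bar> \<le> B" and h_cont: "continuous_on G h"
    and \<alpha>: "0 < \<alpha>" "\<alpha> \<le> 1"
  shows "val h \<alpha> k \<in> borel_measurable (restrict_space borel Y)"
  unfolding borel_measurable_iff_le
proof
  fix a :: real
  have "closed {y \<in> Y. val h \<alpha> k y \<le> a}"
    unfolding closed_sequential_limits
  proof (intro allI impI, elim conjE)
    fix y l
    assume y: "\<forall>n. y n \<in> {y \<in> Y. val h \<alpha> k y \<le> a}" "y \<longlonglongrightarrow> l"
    have "l \<in> Y"
      using y by (intro closed_sequentially[OF Y_closed _ y(2)]) simp
    moreover have "val h \<alpha> k l \<le> a"
      using y(1) by (intro dp_value_epigraph_closed[OF h h_cont \<alpha> _ y(2) tendsto_const]) auto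
    ultimately show "l \<in> {y \<in> Y. val h \<alpha> k y \<le> a}" by simp
  qed
  then have "{y \<in> Y. val h \<alpha> k y \<le> a} \<in> sets borel"
    by simp
  then have "{y \<in> Y. val h \<alpha> k y \<le> a} \<in> sets (restrict_space borel Y)"
    using Y_closed by (subst sets_restrict_space_iff) auto
  then show "{y \<in> space (restrict_space borel Y). val h \<alpha> k y \<le> a} \<in> sets (restrict_space borel Y)"
    by (simp add: space_restrict_space)
qed

text \<open>
  Integrate the dynamic programming inequality; stationarity of \<open>\<gamma>\<close> replaces the value after one step
  by the value before it.
\<close>

lemma integral_dp_value_le:
  assumes \<gamma>: "\<gamma> \<in> W_set Y U f"
    and h: "\<forall>p\<in>G. \<bar>h p\<bar> \<le> B" and h_cont: "continuous_on G h"
    and \<alpha>: "0 < \<alpha>" "\<alpha> \<le> 1"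
  shows "(\<integral>p. val h \<alpha> k (fst p) \<partial>\<gamma>) \<le> (\<Sum>t<k. \<alpha> ^ t) * (\<integral>p. h p \<partial>\<gamma>)"
proof (induction k)
  case (Suc k)
  interpret prob_space \<gamma>
    using W_setD(1)[OF \<gamma>] .
  note space = W_setD(3)[OF \<gamma>]
  have meas: "(\<lambda>p. val h \<alpha> j (g p)) \<in> borel_measurable \<gamma>"
    if "g \<in> borel_measurable \<gamma>" "\<And>p. p \<in> G \<Longrightarrow> g p \<in> Y" for g and j
  proof (rule measurable_compose[OF _ dp_value_measurable[OF h h_cont \<alpha>]])
    show "g \<in> measurable \<gamma> (restrict_space borel Y)"
      using that space by (intro measurable_restrict_space2) auto
  qed
  have int: "integrable \<gamma> (\<lambda>p. val h \<alpha> j (g p))"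
    if "g \<in> borel_measurable \<gamma>" "\<And>p. p \<in> G \<Longrightarrow> g p \<in> Y" for g and j
    using dp_value_bounded[OF h _ \<alpha>(2)] \<alpha>(1) that space
    by (intro integrable_const_bound[of _ "real j * B"] meas) auto
  have int_h: "integrable \<gamma> h"
    using h space by (intro integrable_const_bound[of _ B] W_measurable_cont[OF \<gamma> h_cont]) auto
  have int_f: "integrable \<gamma> (\<lambda>p. val h \<alpha> k (f p))"
    by (intro int W_measurable_f \<gamma> graph_into)
  have "(\<integral>p. val h \<alpha> (Suc k) (fst p) \<partial>\<gamma>) \<le> (\<integral>p. h p + \<alpha> * val h \<alpha> k (f p) \<partial>\<gamma>)"
  proof (rule integral_mono)
    show "integrable \<gamma> (\<lambda>p. val h \<alpha> (Suc k) (fst p))"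
      by (intro int W_measurable_fst \<gamma> graph_fst)
    show "integrable \<gamma> (\<lambda>p. h p + \<alpha> * val h \<alpha> k (f p))"
      using int_h int_f by simp
    show "val h \<alpha> (Suc k) (fst p) \<le> h p + \<alpha> * val h \<alpha> k (f p)" if "p \<in> space \<gamma>" for p
      using dp_value_le[OF h _ \<alpha>(2), of "fst p" "snd p" k] that \<alpha>(1) space by simp
  qed
  also have "\<dots> = (\<integral>p. h p \<partial>\<gamma>) + \<alpha> * (\<integral>p. val h \<alpha> k (f p) \<partial>\<gamma>)"
    using int_h int_f by simp
  also have "(\<integral>p. val h \<alpha> k (f p) \<partial>\<gamma>) = (\<integral>p. val h \<alpha> k (fst p) \<partial>\<gamma>)"
    by (rule W_integral_invariant[OF \<gamma> dp_value_measurable[OF h h_cont \<alpha>]])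
  also have "(\<integral>p. h p \<partial>\<gamma>) + \<alpha> * \<dots> \<le> (\<integral>p. h p \<partial>\<gamma>) + \<alpha> * ((\<Sum>t<k. \<alpha> ^ t) * (\<integral>p. h p \<partial>\<gamma>))"
    using Suc.IH \<alpha>(1) by (intro add_left_mono mult_left_mono) auto
  also have "\<dots> = (\<Sum>t<Suc k. \<alpha> ^ t) * (\<integral>p. h p \<partial>\<gamma>)"
    unfolding sum.lessThan_Suc_shift by (simp add: sum_distrib_left sum_distrib_right algebra_simps)
  finally show ?case .
qed simp

text \<open>
  A lower bound for the costs of all processes is a lower bound for the value function, since
  near-optimal processes exist; integrating it transfers the bound to the measure \<open>\<gamma>\<close>.
\<close>

lemma process_cost_lower_bound_le_integral:
  fixes c :: real
  assumes \<gamma>: "\<gamma> \<in> W_set Y U f"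
    and h: "\<forall>p\<in>G. \<bar>h p\<bar> \<le> B" and h_cont: "continuous_on G h"
    and \<alpha>: "0 < \<alpha>" "\<alpha> \<le> 1"
    and lower: "\<And>y u. y \<in> Y \<Longrightarrow> u \<in> adm_fin Y U f k y \<Longrightarrow> c \<le> (\<Sum>t<k. \<alpha> ^ t * h (traj f y u t, u t))"
  shows "c \<le> (\<Sum>t<k. \<alpha> ^ t) * (\<integral>p. h p \<partial>\<gamma>)"
proof -
  interpret prob_space \<gamma>
    using W_setD(1)[OF \<gamma>] .
  note space = W_setD(3)[OF \<gamma>]
  have ge: "c \<le> val h \<alpha> k y" if "y \<in> Y" for y
  proof (rule field_le_epsilon)
    fix \<epsilon> :: real
    assume "0 < \<epsilon>"
    with dp_value_achieved[of \<alpha> y \<epsilon> k h] that \<alpha>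
    obtain u where "u \<in> adm_fin Y U f k y" "(\<Sum>t<k. \<alpha> ^ t * h (traj f y u t, u t)) < val h \<alpha> k y + \<epsilon>"
      by auto
    with lower[OF that] show "c \<le> val h \<alpha> k y + \<epsilon>"
      by force
  qed
  have "integrable \<gamma> (\<lambda>p. val h \<alpha> k (fst p))"
  proof (rule integrable_const_bound[of _ "real k * B"])
    show "(\<lambda>p. val h \<alpha> k (fst p)) \<in> borel_measurable \<gamma>"
      using W_measurable_fst[OF \<gamma>] graph_fst space
      by (intro measurable_compose[OF _ dp_value_measurable[OF h h_cont \<alpha>]] measurable_restrict_space2) auto
    show "AE p in \<gamma>. norm (val h \<alpha> k (fst p)) \<le> real k * B"
      using dp_value_bounded[OF h _ \<alpha>(2)] \<alpha>(1) space graph_fst by auto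
  qed
  then have "(\<integral>p. c \<partial>\<gamma>) \<le> (\<integral>p. val h \<alpha> k (fst p) \<partial>\<gamma>)"
    using ge graph_fst space by (intro integral_mono) auto
  then have "c \<le> (\<integral>p. val h \<alpha> k (fst p) \<partial>\<gamma>)"
    by (simp add: prob_space)
  also have "\<dots> \<le> (\<Sum>t<k. \<alpha> ^ t) * (\<integral>p. h p \<partial>\<gamma>)"
    by (rule integral_dp_value_le[OF \<gamma> h h_cont \<alpha>])
  finally show ?thesis .
qed

end

section \<open>Discounted and extended-valued costs\<close>

lemma ext_integral_integrable:
  assumes "integrable M h"
  shows "ext_integral M h = ereal (\<integral>x. h x \<partial>M)"
proof -
  have "(\<integral>\<^sup>+ x. ennreal (h x) \<partial>M) \<le> (\<integral>\<^sup>+ x. ennreal (norm (h x)) \<partial>M)"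
    "(\<integral>\<^sup>+ x. ennreal (- h x) \<partial>M) \<le> (\<integral>\<^sup>+ x. ennreal (norm (h x)) \<partial>M)"
    by (intro nn_integral_mono ennreal_leI; simp)+
  moreover have "(\<integral>\<^sup>+ x. ennreal (norm (h x)) \<partial>M) < \<infinity>"
    using assms by (simp add: integrable_iff_bounded)
  ultimately have "(\<integral>\<^sup>+ x. ennreal (h x) \<partial>M) < \<infinity>" "(\<integral>\<^sup>+ x. ennreal (- h x) \<partial>M) < \<infinity>"
    by (auto intro: le_less_trans)
  then show ?thesis
    unfolding ext_integral_def real_lebesgue_integral_def[OF assms]
    by (cases "\<integral>\<^sup>+ x. ennreal (h x) \<partial>M"; cases "\<integral>\<^sup>+ x. ennreal (- h x) \<partial>M") auto
qed

text \<open>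
  If \<open>g\<close> is not integrable, then its positive part has infinite integral, since the negative part is
  bounded; the extended integral is then infinite and the inequality is trivial.
\<close>

lemma (in prob_space) integral_le_ext_integral:
  assumes g: "g \<in> borel_measurable M" and lower: "\<And>x. x \<in> space M \<Longrightarrow> c \<le> g x"
    and h: "integrable M h" "\<And>x. x \<in> space M \<Longrightarrow> h x \<le> g x"
  shows "ereal (\<integral>x. h x \<partial>M) \<le> ext_integral M g"
proof (cases "(\<integral>\<^sup>+ x. ennreal (g x) \<partial>M) = \<infinity>")
  case True
  have "(\<integral>\<^sup>+ x. ennreal (- g x) \<partial>M) \<le> (\<integral>\<^sup>+ x. ennreal (- c) \<partial>M)"
    using lower by (intro nn_integral_mono ennreal_leI) simp
  also have "\<dots> < \<infinity>"
    by (simp add: emeasure_space_1)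
  finally show ?thesis
    using True unfolding ext_integral_def
    by (cases "\<integral>\<^sup>+ x. ennreal (- g x) \<partial>M") auto
next
  case False
  have "integrable M g"
    unfolding integrable_iff_bounded
  proof
    have "(\<integral>\<^sup>+ x. ennreal (norm (g x)) \<partial>M) \<le> (\<integral>\<^sup>+ x. ennreal (g x) + ennreal \<bar>c\<bar> \<partial>M)"
    proof (rule nn_integral_mono)
      fix x
      assume "x \<in> space M"
      then have "c \<le> g x" by (rule lower)
      then show "ennreal (norm (g x)) \<le> ennreal (g x) + ennreal \<bar>c\<bar>"
      proof (cases "0 \<le> g x")
        case False
        then have "ennreal (norm (g x)) \<le> ennreal \<bar>c\<bar>"
          using \<open>c \<le> g x\<close> by (intro ennreal_leI) simp
        then show ?thesis
          by (simp add: add_increasing)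
      qed simp
    qed
    also have "\<dots> = (\<integral>\<^sup>+ x. ennreal (g x) \<partial>M) + ennreal \<bar>c\<bar>"
      using g by (subst nn_integral_add) (auto simp: emeasure_space_1)
    also have "\<dots> < \<infinity>"
      using False by (simp add: top.not_eq_extremum)
    finally show "(\<integral>\<^sup>+ x. ennreal (norm (g x)) \<partial>M) < \<infinity>" .
  qed (rule g)
  then show ?thesis
    using h by (simp add: ext_integral_integrable integral_mono)
qed

lemma discounted_summable:
  assumes "0 < \<alpha>" "\<alpha> < 1" and "\<And>t. \<bar>a t\<bar> \<le> B"
  shows "summable (\<lambda>t. \<alpha> ^ t * a t :: real)"
proof (rule summable_comparison_test')
  show "summable (\<lambda>t. \<alpha> ^ t * B)"
    using assms(1,2) by (intro summable_mult2 summable_geometric) simp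
  show "norm (\<alpha> ^ t * a t) \<le> \<alpha> ^ t * B" for t
    using assms by (simp add: abs_mult mult_left_mono)
qed

text \<open>
  The normalized discounted cost is the mean cost at a geometrically distributed random time.
\<close>

lemma integral_geometric_pmf:
  assumes "0 < \<alpha>" "\<alpha> < 1" and "\<And>t. \<bar>a t\<bar> \<le> B"
  shows "(\<integral>t. a t \<partial>measure_pmf (geometric_pmf (1 - \<alpha>))) = (1 - \<alpha>) * (\<Sum>t. \<alpha> ^ t * a t)"
proof -
  have pmf: "pmf (geometric_pmf (1 - \<alpha>)) t = (1 - \<alpha>) * \<alpha> ^ t" for t
    using assms(1,2) by simp
  have "\<bar>\<bar>a t\<bar>\<bar> \<le> B" for t
    using assms(3) by simp
  from discounted_summable[OF assms(1,2) this]
  have abs: "summable (\<lambda>t. norm ((1 - \<alpha>) * \<alpha> ^ t * a t))"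
    using assms(1,2) by (auto simp: abs_mult mult.assoc intro: summable_mult)
  have "(\<integral>t. a t \<partial>measure_pmf (geometric_pmf (1 - \<alpha>)))
      = (\<integral>t. (1 - \<alpha>) * \<alpha> ^ t * a t \<partial>count_space UNIV)"
    unfolding measure_pmf_eq_density
    using assms(1,2) by (subst integral_density) (auto simp: pmf)
  also have "\<dots> = (\<Sum>t. (1 - \<alpha>) * \<alpha> ^ t * a t)"
    using abs by (intro integral_count_space_nat) (simp add: integrable_count_space_nat_iff)
  also have "\<dots> = (1 - \<alpha>) * (\<Sum>t. \<alpha> ^ t * a t)"
    unfolding mult.assoc by (intro suminf_mult discounted_summable[OF assms])
  finally show ?thesis .
qed

lemma disc_cost_bounded:
  assumes "0 < \<alpha>" "\<alpha> < 1" and "\<And>t. \<bar>h (traj f y u t, u t)\<bar> \<le> B"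
  shows "disc_cost f h \<alpha> y u = ereal (\<Sum>t. \<alpha> ^ t * h (traj f y u t, u t))"
proof -
  have "(\<lambda>t. ereal (\<alpha> ^ t * h (traj f y u t, u t))) sums ereal (\<Sum>t. \<alpha> ^ t * h (traj f y u t, u t))"
    unfolding sums_ereal by (intro summable_sums discounted_summable[OF assms])
  then show ?thesis
    unfolding disc_cost_def by (rule sums_unique[symmetric])
qed

text \<open>
  For series with terms of both signs the extended sum has to be shown to converge: \<open>b\<close> is a summable
  sequence plus a nonnegative one.
\<close>

lemma suminf_ereal_mono_summable:
  assumes a: "summable a" and le: "\<And>t. a t \<le> b t"
  shows "ereal (\<Sum>t. a t) \<le> (\<Sum>t. ereal (b t))"
proof -
  let ?d = "\<Sum>t. ereal (b t - a t)"
  have d: "(\<lambda>n. \<Sum>t<n. ereal (b t - a t)) \<longlonglongrightarrow> ?d"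
    using le by (intro summable_LIMSEQ summable_ereal_pos) simp
  have nonneg: "0 \<le> ?d"
    using le by (intro suminf_0_le) auto
  have a_lim: "(\<lambda>n. ereal (\<Sum>t<n. a t)) \<longlonglongrightarrow> ereal (\<Sum>t. a t)"
    using summable_LIMSEQ[OF a] by simp
  have "(\<lambda>n. ereal (\<Sum>t<n. a t) + (\<Sum>t<n. ereal (b t - a t))) \<longlonglongrightarrow> ereal (\<Sum>t. a t) + ?d"
    using a_lim d nonneg by (intro tendsto_add_ereal_general) auto
  moreover have "ereal (\<Sum>t<n. a t) + (\<Sum>t<n. ereal (b t - a t)) = (\<Sum>t<n. ereal (b t))" for n
    by (simp add: sum_subtractf)
  ultimately have "(\<lambda>t. ereal (b t)) sums (ereal (\<Sum>t. a t) + ?d)"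
    unfolding sums_def by simp
  then have "(\<Sum>t. ereal (b t)) = ereal (\<Sum>t. a t) + ?d"
    by (rule sums_unique[symmetric])
  with nonneg show ?thesis
    by (simp add: add_increasing2)
qed

lemma disc_cost_mono:
  assumes "0 < \<alpha>" "\<alpha> < 1" and "\<And>t. \<bar>h (traj f y u t, u t)\<bar> \<le> B"
    and "\<And>t. h (traj f y u t, u t) \<le> g (traj f y u t, u t)"
  shows "disc_cost f h \<alpha> y u \<le> disc_cost f g \<alpha> y u"
  unfolding disc_cost_bounded[of \<alpha> h f y u, OF assms(1-3)] unfolding disc_cost_def
  using assms(1,4) by (intro suminf_ereal_mono_summable discounted_summable[OF assms(1-3)] mult_left_mono) auto

lemma V_disc_minimizer:
  assumes opt: "optimal_disc Y U f g \<alpha> y0 u0" and cost: "disc_cost f g \<alpha> y0 u0 = ereal v" and \<alpha>: "\<alpha> < 1"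
  shows "V_disc Y U f g \<alpha> y0 = ereal ((1 - \<alpha>) * v)"
    and "z \<in> Y \<Longrightarrow> ereal ((1 - \<alpha>) * v) \<le> V_disc Y U f g \<alpha> z"
proof -
  have lower: "ereal ((1 - \<alpha>) * v) \<le> V_disc Y U f g \<alpha> z" if "z \<in> Y" for z
  proof -
    have "ereal v \<le> (INF u\<in>adm Y U f z. disc_cost f g \<alpha> z u)"
      using opt that unfolding optimal_disc_def cost by (intro INF_greatest) auto
    then have "ereal (1 - \<alpha>) * ereal v \<le> V_disc Y U f g \<alpha> z"
      unfolding V_disc_def using \<alpha> by (intro ereal_mult_left_mono) auto
    then show ?thesis by simp
  qed
  then show "z \<in> Y \<Longrightarrow> ereal ((1 - \<alpha>) * v) \<le> V_disc Y U f g \<alpha> z" .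
  have "(INF u\<in>adm Y U f y0. disc_cost f g \<alpha> y0 u) \<le> ereal v"
    unfolding cost[symmetric] using opt unfolding optimal_disc_def by (intro INF_lower) auto
  then have "V_disc Y U f g \<alpha> y0 \<le> ereal (1 - \<alpha>) * ereal v"
    unfolding V_disc_def using \<alpha> by (intro ereal_mult_left_mono) auto
  then show "V_disc Y U f g \<alpha> y0 = ereal ((1 - \<alpha>) * v)"
    using lower[of y0] opt unfolding optimal_disc_def by (intro antisym) auto
qed

lemma V_fin_minimizer:
  assumes opt: "optimal_fin Y U f g S y0 u0" and ne: "\<forall>y\<in>Y. adm_fin Y U f S y \<noteq> {}"
  shows "V_fin Y U f g S y0 = fin_cost f g S y0 u0 / real S"
    and "z \<in> Y \<Longrightarrow> fin_cost f g S y0 u0 / real S \<le> V_fin Y U f g S z"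
proof -
  have "fin_cost f g S y0 u0 \<le> (INF u\<in>adm_fin Y U f S z. fin_cost f g S z u)" if "z \<in> Y"
    using opt ne that unfolding optimal_fin_def by (intro cINF_greatest) auto
  then show "fin_cost f g S y0 u0 / real S \<le> V_fin Y U f g S z" if "z \<in> Y"
    using that unfolding V_fin_def by (simp add: divide_right_mono)
  have "(INF u\<in>adm_fin Y U f S y0. fin_cost f g S y0 u) = fin_cost f g S y0 u0"
    using opt unfolding optimal_fin_def by (intro cInf_eq_minimum) auto
  then show "V_fin Y U f g S y0 = fin_cost f g S y0 u0 / real S"
    unfolding V_fin_def by simp
qed

text \<open>
  Truncation lowers the cost of every process and leaves the cost of the given one unchanged, so
  optimality for the truncated cost implies optimality for the original one.
\<close>

lemma optimal_disc_of_truncated: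
  assumes opt: "optimal_disc Y U f (truncate_cost g M) \<alpha> y0 u0"
    and \<alpha>: "0 < \<alpha>" "\<alpha> < 1"
    and below: "\<And>p. p \<in> graph_set Y U f \<Longrightarrow> c \<le> g p"
    and le_M: "\<And>t. g (traj f y0 u0 t, u0 t) \<le> M"
  shows "optimal_disc Y U f g \<alpha> y0 u0"
    and "disc_cost f g \<alpha> y0 u0 = ereal (\<Sum>t. \<alpha> ^ t * g (traj f y0 u0 t, u0 t))"
proof -
  have eq: "truncate_cost g M (traj f y0 u0 t, u0 t) = g (traj f y0 u0 t, u0 t)" for t
    using le_M by (simp add: truncate_cost_def)
  have cost_eq: "disc_cost f (truncate_cost g M) \<alpha> y0 u0 = disc_cost f g \<alpha> y0 u0"
    unfolding disc_cost_def by (simp add: eq)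
  have bound: "\<bar>truncate_cost g M p\<bar> \<le> max \<bar>c\<bar> \<bar>M\<bar>" if "p \<in> graph_set Y U f" for p
    using below[OF that] unfolding truncate_cost_def by (auto simp: min_def max_def)
  have in_graph: "(traj f z v t, v t) \<in> graph_set Y U f" if "v \<in> adm Y U f z" for z v t
    using that by (simp add: adm_def)
  have u0: "u0 \<in> adm Y U f y0"
    using opt by (simp add: optimal_disc_def)
  show "optimal_disc Y U f g \<alpha> y0 u0"
    unfolding optimal_disc_def
  proof (intro conjI ballI)
    show "y0 \<in> Y" "u0 \<in> adm Y U f y0"
      using opt by (simp_all add: optimal_disc_def)
    fix z v
    assume z: "z \<in> Y" "v \<in> adm Y U f z"
    have "disc_cost f g \<alpha> y0 u0 \<le> disc_cost f (truncate_cost g M) \<alpha> z v"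
      using opt z unfolding optimal_disc_def cost_eq by blast
    also have "\<dots> \<le> disc_cost f g \<alpha> z v"
      using bound[OF in_graph[OF z(2)]] by (intro disc_cost_mono[OF \<alpha>]) (auto simp: truncate_cost_def)
    finally show "disc_cost f g \<alpha> y0 u0 \<le> disc_cost f g \<alpha> z v" .
  qed
  show "disc_cost f g \<alpha> y0 u0 = ereal (\<Sum>t. \<alpha> ^ t * g (traj f y0 u0 t, u0 t))"
    using bound[OF in_graph[OF u0]] unfolding eq by (rule disc_cost_bounded[OF \<alpha>])
qed

lemma optimal_fin_of_truncated:
  assumes opt: "optimal_fin Y U f (truncate_cost g M) S y0 u0"
    and le_M: "\<And>t. t < S \<Longrightarrow> g (traj f y0 u0 t, u0 t) \<le> M"
  shows "optimal_fin Y U f g S y0 u0"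
  unfolding optimal_fin_def
proof (intro conjI ballI)
  show "y0 \<in> Y" "u0 \<in> adm_fin Y U f S y0"
    using opt by (simp_all add: optimal_fin_def)
  fix z v
  assume z: "z \<in> Y" "v \<in> adm_fin Y U f S z"
  have "fin_cost f g S y0 u0 = fin_cost f (truncate_cost g M) S y0 u0"
    unfolding fin_cost_def using le_M by (intro sum.cong) (auto simp: truncate_cost_def)
  also have "\<dots> \<le> fin_cost f (truncate_cost g M) S z v"
    using opt z unfolding optimal_fin_def by blast
  also have "\<dots> \<le> fin_cost f g S z v"
    unfolding fin_cost_def by (intro sum_mono) (simp add: truncate_cost_def)
  finally show "fin_cost f g S y0 u0 \<le> fin_cost f g S z v" .
qed

context control_system
begin

lemma adm_subset_adm_fin: "adm Y U f y \<subseteq> adm_fin Y U f k y"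
  by (auto simp: adm_def adm_fin_def)

text \<open>
  Viability lets every finite process continue forever, so that a lower bound for infinite
  processes says something about finite ones.
\<close>

lemma adm_fin_extend:
  assumes y: "y \<in> Y" and u: "u \<in> adm_fin Y U f k y"
  shows "\<exists>w\<in>adm Y U f y. \<forall>t<k. w t = u t \<and> traj f y w t = traj f y u t"
proof -
  have "traj f y u k \<in> Y"
  proof (cases k)
    case (Suc j)
    then have "(traj f y u j, u j) \<in> G"
      using u by (simp add: adm_fin_def)
    from graph_into[OF this] show ?thesis
      by (simp add: Suc)
  qed (simp add: y)
  then obtain v where v: "v \<in> adm Y U f (traj f y u k)"
    using viable by blast
  define w where "w t = (if t < k then u t else v (t - k))" for t
  have before: "traj f y w t = traj f y u t" if "t \<le> k" for t
    using that by (induction t) (auto simp: w_def)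
  have w_after: "w (k + t) = v t" for t
    by (simp add: w_def)
  have after: "traj f y w (k + t) = traj f (traj f y u k) v t" for t
    by (induction t) (simp_all add: before w_after)
  have "(traj f y w t, w t) \<in> G" for t
  proof (cases "t < k")
    case True
    then show ?thesis
      using u before[of t] by (simp add: adm_fin_def w_def)
  next
    case False
    then have "t = k + (t - k)" by simp
    then show ?thesis
      using v after[of "t - k"] False by (simp add: adm_def w_def)
  qed
  then show ?thesis
    using before by (intro bexI[of _ w]) (auto simp: adm_def w_def)
qed

text \<open>
  Cutting an infinite process after \<open>k\<close> steps changes its discounted cost by at most
  \<open>\<alpha>\<^sup>k B / (1 - \<alpha>)\<close>. Apply the bound for \<open>k\<close> steps and let \<open>k\<close> tend to infinity.
\<close>

lemma discounted_cost_lower_bound_le_integral: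
  fixes h :: "'a \<times> 'u \<Rightarrow> real"
  assumes \<gamma>: "\<gamma> \<in> W_set Y U f"
    and h: "\<forall>p\<in>G. \<bar>h p\<bar> \<le> B" and h_cont: "continuous_on G h"
    and \<alpha>: "0 < \<alpha>" "\<alpha> < 1"
    and lower: "\<And>y u. y \<in> Y \<Longrightarrow> u \<in> adm Y U f y \<Longrightarrow> c \<le> (\<Sum>t. \<alpha> ^ t * h (traj f y u t, u t))"
  shows "(1 - \<alpha>) * c \<le> (\<integral>p. h p \<partial>\<gamma>)"
proof -
  have "c - \<alpha> ^ k * (B / (1 - \<alpha>)) \<le> (\<Sum>t<k. \<alpha> ^ t) * (\<integral>p. h p \<partial>\<gamma>)" for k
  proof (rule process_cost_lower_bound_le_integral[OF \<gamma> h h_cont \<alpha>(1)])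
    fix y u
    assume y: "y \<in> Y" and u: "u \<in> adm_fin Y U f k y"
    obtain w where w: "w \<in> adm Y U f y" "\<And>t. t < k \<Longrightarrow> w t = u t \<and> traj f y w t = traj f y u t"
      using adm_fin_extend[OF y u] by blast
    define a where "a t = h (traj f y w t, w t)" for t
    have a: "\<bar>a t\<bar> \<le> B" for t
      using w(1) h by (auto simp: a_def adm_def)
    have "c \<le> (\<Sum>t. \<alpha> ^ t * a t)"
      unfolding a_def by (rule lower[OF y w(1)])
    also have "\<dots> = (\<Sum>t. \<alpha> ^ (t + k) * a (t + k)) + (\<Sum>t<k. \<alpha> ^ t * a t)"
      by (rule suminf_split_initial_segment[OF discounted_summable[OF \<alpha> a]])
    also have "(\<Sum>t. \<alpha> ^ (t + k) * a (t + k)) \<le> (\<Sum>t. \<alpha> ^ k * B * \<alpha> ^ t)"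
    proof (rule suminf_le)
      show "\<alpha> ^ (t + k) * a (t + k) \<le> \<alpha> ^ k * B * \<alpha> ^ t" for t
        using a[of "t + k"] \<alpha>(1) by (simp add: power_add mult.commute mult.left_commute)
      show "summable (\<lambda>t. \<alpha> ^ (t + k) * a (t + k))"
        by (rule summable_ignore_initial_segment[OF discounted_summable[OF \<alpha> a]])
      show "summable (\<lambda>t. \<alpha> ^ k * B * \<alpha> ^ t)"
        using \<alpha> by (intro summable_mult summable_geometric) simp
    qed
    also have "(\<Sum>t. \<alpha> ^ k * B * \<alpha> ^ t) = \<alpha> ^ k * (B / (1 - \<alpha>))"
      using \<alpha> by (subst suminf_mult) (simp_all add: suminf_geometric summable_geometric)
    also have "(\<Sum>t<k. \<alpha> ^ t * a t) = (\<Sum>t<k. \<alpha> ^ t * h (traj f y u t, u t))"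
      using w(2) by (intro sum.cong) (auto simp: a_def)
    finally show "c - \<alpha> ^ k * (B / (1 - \<alpha>)) \<le> (\<Sum>t<k. \<alpha> ^ t * h (traj f y u t, u t))"
      by simp
  qed (use \<alpha> in simp)
  moreover have "(\<lambda>k. c - \<alpha> ^ k * (B / (1 - \<alpha>))) \<longlonglongrightarrow> c - 0 * (B / (1 - \<alpha>))"
    using \<alpha> by (intro tendsto_intros LIMSEQ_realpow_zero) auto
  moreover have "(\<lambda>k. (\<Sum>t<k. \<alpha> ^ t) * (\<integral>p. h p \<partial>\<gamma>)) \<longlonglongrightarrow> 1 / (1 - \<alpha>) * (\<integral>p. h p \<partial>\<gamma>)"
    using geometric_sums[of \<alpha>] \<alpha> unfolding sums_def by (intro tendsto_intros) simp
  ultimately have "c \<le> 1 / (1 - \<alpha>) * (\<integral>p. h p \<partial>\<gamma>)"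
    by (intro LIMSEQ_le[where X = "\<lambda>k. c - \<alpha> ^ k * (B / (1 - \<alpha>))"]) auto
  then show ?thesis
    using \<alpha> by (simp add: field_simps)
qed

end

section \<open>Occupation measures accumulate at stationary measures\<close>

text \<open>
  Along a trajectory the increments of \<open>\<phi>\<close> telescope.
\<close>

lemma occupation_fin_almost_invariant:
  assumes S: "0 < S" and K: "\<And>t. t < S \<Longrightarrow> (traj f y u t, u t) \<in> K"
    and \<phi>: "\<forall>p\<in>K. \<bar>\<phi> (fst p)\<bar> \<le> b \<and> \<bar>\<phi> (f p)\<bar> \<le> b"
  shows "\<bar>\<integral>t. \<phi> (f (traj f y u t, u t)) - \<phi> (fst (traj f y u t, u t)) \<partial>measure_pmf (pmf_of_set {..<S})\<bar>
    \<le> 2 * b * (1 / real S)"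
proof -
  have "(\<integral>t. \<phi> (f (traj f y u t, u t)) - \<phi> (fst (traj f y u t, u t)) \<partial>measure_pmf (pmf_of_set {..<S}))
      = (\<Sum>t<S. \<phi> (traj f y u (Suc t)) - \<phi> (traj f y u t)) / real S"
    using S by (subst integral_pmf_of_set) auto
  also have "\<dots> = (\<phi> (traj f y u S) - \<phi> y) / real S"
    by (subst sum_lessThan_telescope) simp
  finally have eq: "(\<integral>t. \<phi> (f (traj f y u t, u t)) - \<phi> (fst (traj f y u t, u t)) \<partial>measure_pmf (pmf_of_set {..<S}))
      = (\<phi> (traj f y u S) - \<phi> y) / real S" .
  obtain s where s: "S = Suc s"
    using S by (cases S) auto
  have "\<bar>\<phi> (traj f y u S)\<bar> \<le> b" "\<bar>\<phi> y\<bar> \<le> b"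
    using bspec[OF \<phi> K[of s]] bspec[OF \<phi> K[of 0]] by (auto simp: s)
  then have "\<bar>\<phi> (traj f y u S) - \<phi> y\<bar> \<le> 2 * b"
    by linarith
  then show ?thesis
    unfolding eq using S by (simp add: divide_right_mono)
qed

text \<open>
  Discounted telescoping: with \<open>E\<close> the mean at a geometric time,
  \<open>E(\<phi>\<^sub>t\<^sub>+\<^sub>1 - \<phi>\<^sub>t) = (1 - \<alpha>) (E \<phi>\<^sub>t\<^sub>+\<^sub>1 - \<phi>\<^sub>0)\<close>.
\<close>

lemma occupation_disc_almost_invariant:
  assumes \<alpha>: "0 < \<alpha>" "\<alpha> < 1" and K: "\<And>t. (traj f y u t, u t) \<in> K"
    and \<phi>: "\<forall>p\<in>K. \<bar>\<phi> (fst p)\<bar> \<le> b \<and> \<bar>\<phi> (f p)\<bar> \<le> b"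
  shows "\<bar>\<integral>t. \<phi> (f (traj f y u t, u t)) - \<phi> (fst (traj f y u t, u t)) \<partial>measure_pmf (geometric_pmf (1 - \<alpha>))\<bar>
    \<le> 2 * b * (1 - \<alpha>)"
proof -
  let ?E = "measure_pmf.expectation (geometric_pmf (1 - \<alpha>))"
  define a where "a t = \<phi> (traj f y u t)" for t
  have a: "\<bar>a t\<bar> \<le> b" for t
    using bspec[OF \<phi> K[of t]] by (simp add: a_def)
  have int: "integrable (measure_pmf (geometric_pmf (1 - \<alpha>))) (\<lambda>t. a (k t))" for k :: "nat \<Rightarrow> nat"
    using a by (intro measure_pmf.integrable_const_bound[of _ b]) auto
  have split: "(\<Sum>t. \<alpha> ^ t * a t) = a 0 + \<alpha> * (\<Sum>t. \<alpha> ^ t * a (Suc t))"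
  proof -
    have "(\<Sum>t. \<alpha> ^ Suc t * a (Suc t)) = (\<Sum>t. \<alpha> ^ t * a t) - a 0"
      using suminf_split_head[OF discounted_summable[OF \<alpha> a]] by simp
    moreover have "(\<Sum>t. \<alpha> ^ Suc t * a (Suc t)) = \<alpha> * (\<Sum>t. \<alpha> ^ t * a (Suc t))"
      using suminf_mult[OF discounted_summable[OF \<alpha>, of "\<lambda>t. a (Suc t)" b], of \<alpha>] a
      by (simp add: mult.assoc)
    ultimately show ?thesis by simp
  qed
  have E0: "?E a = (1 - \<alpha>) * (\<Sum>t. \<alpha> ^ t * a t)"
    by (rule integral_geometric_pmf[OF \<alpha> a])
  have E1: "?E (\<lambda>t. a (Suc t)) = (1 - \<alpha>) * (\<Sum>t. \<alpha> ^ t * a (Suc t))"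
    by (rule integral_geometric_pmf[OF \<alpha>]) (rule a)
  have "?E (\<lambda>t. a (Suc t) - a t) = ?E (\<lambda>t. a (Suc t)) - ?E a"
    using int[of Suc] int[of "\<lambda>t. t"] by (rule Bochner_Integration.integral_diff)
  also have "\<dots> = (1 - \<alpha>) * (?E (\<lambda>t. a (Suc t)) - a 0)"
    unfolding E0 E1 split by (simp add: algebra_simps)
  finally have eq: "?E (\<lambda>t. a (Suc t) - a t) = (1 - \<alpha>) * (?E (\<lambda>t. a (Suc t)) - a 0)" .
  have "\<bar>?E (\<lambda>t. a (Suc t))\<bar> \<le> b"
  proof -
    have "?E (\<lambda>t. a (Suc t)) \<le> b"
      using a by (intro measure_pmf.integral_le_const int) (auto simp: abs_le_iff)
    moreover have "- b \<le> ?E (\<lambda>t. a (Suc t))"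
    proof (intro measure_pmf.integral_ge_const int AE_I2)
      show "- b \<le> a (Suc t)" for t
        using a[of "Suc t"] by linarith
    qed
    ultimately show ?thesis by linarith
  qed
  then have "\<bar>?E (\<lambda>t. a (Suc t)) - a 0\<bar> \<le> 2 * b"
    using a[of 0] by linarith
  then have "\<bar>?E (\<lambda>t. a (Suc t) - a t)\<bar> \<le> (1 - \<alpha>) * (2 * b)"
    unfolding eq abs_mult using \<alpha> by (simp add: mult_left_mono)
  then show ?thesis
    by (simp add: a_def mult.commute)
qed

context control_system
begin

text \<open>
  Distributions on \<open>K\<close> that are stationary up to errors \<open>\<epsilon> n \<rightarrow> 0\<close> have a stationary weak limit, and
  the cost, being continuous on \<open>K\<close>, passes to the limit. The factor \<open>2 * b\<close> in the error is what
  telescoping produces for a test function bounded by \<open>b\<close> on the points and their successors.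
\<close>

lemma almost_invariant_family_imp_W:
  fixes p :: "nat \<Rightarrow> 'i pmf" and g :: "'a \<times> 'u \<Rightarrow> real"
  assumes K: "compact K" "K \<subseteq> G" and xK: "\<And>n i. i \<in> set_pmf (p n) \<Longrightarrow> x n i \<in> K"
    and \<epsilon>: "\<epsilon> \<longlonglongrightarrow> 0"
    and inv: "\<And>n (\<phi> :: 'a \<Rightarrow> real) b. \<forall>p\<in>K. \<bar>\<phi> (fst p)\<bar> \<le> b \<and> \<bar>\<phi> (f p)\<bar> \<le> b \<Longrightarrow>
      \<bar>\<integral>i. \<phi> (f (x n i)) - \<phi> (fst (x n i)) \<partial>measure_pmf (p n)\<bar> \<le> 2 * b * \<epsilon> n"
    and g: "continuous_on G g" and cost: "\<And>n. (\<integral>i. g (x n i) \<partial>measure_pmf (p n)) \<le> c"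
  shows "\<exists>\<gamma>\<in>W_set Y U f. ext_integral \<gamma> g \<le> ereal c"
proof -
  have "\<exists>r \<mu> q. strict_mono r \<and> prob_space \<mu> \<and> sets \<mu> = sets (borel :: real measure) \<and>
    q \<in> borel_measurable borel \<and> range q \<subseteq> K \<and>
    (\<forall>F :: 'a \<times> 'u \<Rightarrow> real. continuous_on K F \<longrightarrow>
      (\<lambda>n. \<integral>i. F (x (r n) i) \<partial>measure_pmf (p (r n))) \<longlonglongrightarrow> (\<integral>s. F (q s) \<partial>\<mu>))"
    by (rule pmf_family_on_compact_has_limit[OF K(1) xK])
  then obtain r \<mu> and q :: "real \<Rightarrow> 'a \<times> 'u"
    where r: "strict_mono r" and \<mu>: "prob_space \<mu>" "sets \<mu> = sets borel"
    and q: "q \<in> borel_measurable borel" "range q \<subseteq> K"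
    and lim': "\<forall>F :: 'a \<times> 'u \<Rightarrow> real. continuous_on K F \<longrightarrow>
      (\<lambda>n. \<integral>i. F (x (r n) i) \<partial>measure_pmf (p (r n))) \<longlonglongrightarrow> (\<integral>s. F (q s) \<partial>\<mu>)"
    by (elim exE conjE) (rule that)
  note lim = lim'[rule_format]
  interpret \<mu>: prob_space \<mu> by fact
  have q_meas: "q \<in> measurable \<mu> (restrict_space borel G)"
    using q K(2) \<mu>(2) by (intro measurable_restrict_space2) (auto simp: measurable_def sets_eq_imp_space_eq)
  define \<gamma> where "\<gamma> = distr \<mu> (restrict_space borel G) q"
  have int_\<gamma>: "(\<integral>p. F p \<partial>\<gamma>) = (\<integral>s. F (q s) \<partial>\<mu>)" if "continuous_on G F" for F :: "'a \<times> 'u \<Rightarrow> real"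
    unfolding \<gamma>_def using q_meas borel_measurable_continuous_on_restrict[OF that] by (rule integral_distr)
  have f_cont_G: "continuous_on G f"
    using f_cont by (rule graph_cont)
  have "(\<integral>p. \<phi> (f p) - \<phi> (fst p) \<partial>\<gamma>) = 0" if \<phi>: "\<phi> \<in> C_compactified Y" for \<phi>
  proof -
    have \<phi>_cont: "continuous_on Y \<phi>"
      using \<phi> by (simp add: C_compactified_def)
    have c1: "continuous_on G (\<lambda>p. \<phi> (f p))"
      using graph_into by (intro continuous_on_compose2[OF \<phi>_cont f_cont_G]) auto
    have c2: "continuous_on G (\<lambda>p. \<phi> (fst p))"
      using graph_fst by (intro continuous_on_compose2[OF \<phi>_cont]) (auto intro: continuous_intros)
    have cG: "continuous_on G (\<lambda>p. \<phi> (f p) - \<phi> (fst p))"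
      using c1 c2 by (rule continuous_on_diff)
    have bdd: "\<exists>b. \<forall>p\<in>K. \<bar>F p\<bar> \<le> b" if "continuous_on G F" for F :: "'a \<times> 'u \<Rightarrow> real"
      using compact_imp_bounded[OF compact_continuous_image[OF continuous_on_subset[OF that K(2)] K(1)]]
      unfolding bounded_real by blast
    obtain b1 b2 where b: "\<And>p. p \<in> K \<Longrightarrow> \<bar>\<phi> (fst p)\<bar> \<le> b1" "\<And>p. p \<in> K \<Longrightarrow> \<bar>\<phi> (f p)\<bar> \<le> b2"
      using bdd[OF c1] bdd[OF c2] by blast
    have "\<forall>p\<in>K. \<bar>\<phi> (fst p)\<bar> \<le> max b1 b2 \<and> \<bar>\<phi> (f p)\<bar> \<le> max b1 b2"
      using b by (simp add: le_max_iff_disj)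
    note bound = inv[of \<phi> "max b1 b2", OF this]
    have "(\<lambda>n. \<epsilon> (r n)) \<longlonglongrightarrow> 0"
      using LIMSEQ_subseq_LIMSEQ[OF \<epsilon> r] by (simp add: o_def)
    then have "(\<lambda>n. 2 * max b1 b2 * \<epsilon> (r n)) \<longlonglongrightarrow> 0"
      by (rule tendsto_mult_right_zero)
    then have "(\<lambda>n. \<integral>i. \<phi> (f (x (r n) i)) - \<phi> (fst (x (r n) i)) \<partial>measure_pmf (p (r n))) \<longlonglongrightarrow> 0"
      by (rule Lim_null_comparison[OF always_eventually, rotated]) (unfold real_norm_def, rule allI, rule bound)
    moreover have "(\<lambda>n. \<integral>i. \<phi> (f (x (r n) i)) - \<phi> (fst (x (r n) i)) \<partial>measure_pmf (p (r n)))
        \<longlonglongrightarrow> (\<integral>s. \<phi> (f (q s)) - \<phi> (fst (q s)) \<partial>\<mu>)"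
      by (rule lim[OF continuous_on_subset[OF cG K(2)]])
    ultimately show ?thesis
      unfolding int_\<gamma>[OF cG] by (intro LIMSEQ_unique)
  qed
  then have W: "\<gamma> \<in> W_set Y U f"
    unfolding W_set_def using q_meas by (auto simp: \<gamma>_def \<mu>.prob_space_distr)
  obtain b where b: "\<And>p. p \<in> K \<Longrightarrow> \<bar>g p\<bar> \<le> b"
    using compact_imp_bounded[OF compact_continuous_image[OF continuous_on_subset[OF g K(2)] K(1)]]
    unfolding bounded_real by blast
  have g_meas: "g \<in> borel_measurable (restrict_space borel G)"
    by (rule borel_measurable_continuous_on_restrict[OF g])
  have "q s \<in> K" for s
    using q(2) by blast
  then have "integrable \<mu> (\<lambda>s. g (q s))"
    using b measurable_compose[OF q_meas g_meas]
    by (intro \<mu>.integrable_const_bound[of _ b] always_eventually) simp_all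
  then have "integrable \<gamma> g"
    unfolding \<gamma>_def by (subst integrable_distr_eq[OF q_meas g_meas])
  then have "ext_integral \<gamma> g = ereal (\<integral>s. g (q s) \<partial>\<mu>)"
    by (simp add: ext_integral_integrable int_\<gamma>[OF g])
  moreover have "(\<integral>s. g (q s) \<partial>\<mu>) \<le> c"
    using lim[OF continuous_on_subset[OF g K(2)]] cost by (intro LIMSEQ_le_const2) auto
  ultimately show ?thesis
    using W by (intro bexI[of _ \<gamma>]) simp_all
qed

end

section \<open>The long-run optimal values\<close>

theorem theorem5p7:
  fixes Y :: "(real ^ 'm) set"
    and U0 :: "'u::metric_space set"
    and U :: "real ^ 'm \<Rightarrow> 'u set"
    and f :: "(real ^ 'm) \<times> 'u \<Rightarrow> real ^ 'm"
    and g :: "(real ^ 'm) \<times> 'u \<Rightarrow> real"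
    and M1 :: real
    and D :: "((real ^ 'm) \<times> 'u) set"
  assumes "Y \<noteq> {}" and "closed Y" and "\<not> bounded Y"
    and "compact U0"
    and "\<forall>y\<in>Y. U y \<subseteq> U0 \<and> compact (U y)"
    and "usc_on Y U"
    and "continuous_on (UNIV \<times> U0) f"
    and "\<forall>K. \<exists>R. \<forall>y. \<forall>u\<in>U0. norm y \<ge> R \<longrightarrow> norm (f (y, u)) \<ge> K"
    and "\<forall>y0\<in>Y. adm Y U f y0 \<noteq> {}"
    and "continuous_on (UNIV \<times> U0) g"
    and "\<exists>c. \<forall>p\<in>UNIV \<times> U0. c \<le> g p"
    and "D \<subseteq> graph_set Y U f" and "bounded D"
    and "\<And>M \<alpha>. M > 0 \<Longrightarrow> M \<ge> M1 \<Longrightarrow> 0 < \<alpha> \<Longrightarrow> \<alpha> < 1 \<Longrightarrow>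
           (\<exists>y0 u. optimal_disc Y U f (truncate_cost g M) \<alpha> y0 u) \<and>
           (\<forall>y0 u. optimal_disc Y U f (truncate_cost g M) \<alpha> y0 u \<longrightarrow>
              (\<forall>t. (traj f y0 u t, u t) \<in> D))"
    and "\<And>M S. M > 0 \<Longrightarrow> M \<ge> M1 \<Longrightarrow> S > 0 \<Longrightarrow>
           (\<exists>y0 u. optimal_fin Y U f (truncate_cost g M) S y0 u) \<and>
           (\<forall>y0 u. optimal_fin Y U f (truncate_cost g M) S y0 u \<longrightarrow>
              (\<forall>t<S. (traj f y0 u t, u t) \<in> D))"
  shows "(\<forall>\<alpha>. 0 < \<alpha> \<and> \<alpha> < 1 \<longrightarrow> (\<exists>y\<in>Y. \<forall>z\<in>Y. V_disc Y U f g \<alpha> y \<le> V_disc Y U f g \<alpha> z)) \<and>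
         (\<forall>S>0. \<exists>y\<in>Y. \<forall>z\<in>Y. V_fin Y U f g S y \<le> V_fin Y U f g S z) \<and>
         (\<exists>l::real. g_star Y U f g = ereal l \<and>
            ((\<lambda>\<alpha>. INF y\<in>Y. V_disc Y U f g \<alpha> y) \<longlongrightarrow> ereal l) (at_left 1) \<and>
            (\<lambda>S. INF y\<in>Y. V_fin Y U f g S y) \<longlonglongrightarrow> l)"
proof -
  interpret control_system Y U0 U f
    using assms(2,4-7,9) by unfold_locales
  have g_cont: "continuous_on G g"
    using assms(10) by (rule graph_cont)
  obtain c where c: "\<And>p. p \<in> G \<Longrightarrow> c \<le> g p"
    using assms(11) graph_subset by blast
  obtain K where K: "compact K" "K \<subseteq> G" "D \<subseteq> K"
    using bounded_in_compact_graph[OF assms(12,13)] by blast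
  obtain b where b: "\<And>p. p \<in> K \<Longrightarrow> \<bar>g p\<bar> \<le> b"
    using compact_imp_bounded[OF compact_continuous_image[OF continuous_on_subset[OF g_cont K(2)] K(1)]]
    unfolding bounded_real by blast
  \<comment> \<open>\<open>M\<close> dominates \<open>g\<close> on \<open>K\<close>, so truncation at \<open>M\<close> is invisible along optimal processes.\<close>
  define M where "M = max (max M1 b) 1"
  have M: "M > 0" "M \<ge> M1" and g_le_M: "\<And>p. p \<in> D \<Longrightarrow> g p \<le> M"
    using b K(3) by (auto simp: M_def abs_le_iff le_max_iff_disj)
  let ?h = "truncate_cost g M"
  have h_cont: "continuous_on G ?h"
    unfolding truncate_cost_def by (intro continuous_intros g_cont)
  have h_bound: "\<forall>p\<in>G. \<bar>?h p\<bar> \<le> max \<bar>c\<bar> M"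
  proof
    fix p
    assume "p \<in> G"
    then show "\<bar>?h p\<bar> \<le> max \<bar>c\<bar> M"
      using c[of p] M(1) unfolding truncate_cost_def by linarith
  qed
  have h_le_g: "?h p \<le> g p" for p
    by (simp add: truncate_cost_def)
  let ?L = "g_star Y U f g"
  have le_g_star: "ereal a \<le> ?L" if "\<And>\<gamma>. \<gamma> \<in> W_set Y U f \<Longrightarrow> a \<le> (\<integral>p. ?h p \<partial>\<gamma>)" for a
    unfolding g_star_def
  proof (rule INF_greatest)
    fix \<gamma>
    assume \<gamma>: "\<gamma> \<in> W_set Y U f"
    interpret \<gamma>: prob_space \<gamma>
      using W_setD(1)[OF \<gamma>] .
    have "ereal a \<le> ereal (\<integral>p. ?h p \<partial>\<gamma>)"
      using that[OF \<gamma>] by simp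
    also have "\<dots> \<le> ext_integral \<gamma> g"
    proof (rule \<gamma>.integral_le_ext_integral)
      show "integrable \<gamma> ?h"
        using h_bound W_setD(3)[OF \<gamma>]
        by (intro \<gamma>.integrable_const_bound[of _ "max \<bar>c\<bar> M"] W_measurable_cont[OF \<gamma> h_cont]) auto
    qed (use c W_setD(3)[OF \<gamma>] W_measurable_cont[OF \<gamma> g_cont] h_le_g in auto)
    finally show "ereal a \<le> ext_integral \<gamma> g" .
  qed

  have "\<exists>y u. optimal_disc Y U f ?h \<alpha> y u \<and> (\<forall>t. (traj f y u t, u t) \<in> D)" if "0 < \<alpha> \<and> \<alpha> < 1" for \<alpha>
    using assms(14)[OF M, of \<alpha>] that by blast
  then obtain yd ud where opt_d: "\<And>\<alpha>. 0 < \<alpha> \<and> \<alpha> < 1 \<Longrightarrow> optimal_disc Y U f ?h \<alpha> (yd \<alpha>) (ud \<alpha>)"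
    and D_d: "\<And>\<alpha> t. 0 < \<alpha> \<and> \<alpha> < 1 \<Longrightarrow> (traj f (yd \<alpha>) (ud \<alpha>) t, ud \<alpha> t) \<in> D"
    by metis
  define xd where "xd \<alpha> t = (traj f (yd \<alpha>) (ud \<alpha>) t, ud \<alpha> t)" for \<alpha> t
  define vd where "vd \<alpha> = (\<Sum>t. \<alpha> ^ t * g (xd \<alpha> t))" for \<alpha>
  have opt_disc: "optimal_disc Y U f g \<alpha> (yd \<alpha>) (ud \<alpha>)"
    and cost_disc: "disc_cost f g \<alpha> (yd \<alpha>) (ud \<alpha>) = ereal (vd \<alpha>)" if \<alpha>: "0 < \<alpha>" "\<alpha> < 1" for \<alpha>
    using optimal_disc_of_truncated[OF opt_d[OF conjI[OF \<alpha>]] \<alpha> c g_le_M[OF D_d[OF conjI[OF \<alpha>]]]]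
    by (simp_all add: vd_def xd_def)
  have yd: "yd \<alpha> \<in> Y" if "0 < \<alpha>" "\<alpha> < 1" for \<alpha>
    using opt_disc[OF that] by (simp add: optimal_disc_def)
  have INF_disc: "(INF y\<in>Y. V_disc Y U f g \<alpha> y) = ereal ((1 - \<alpha>) * vd \<alpha>)" if \<alpha>: "0 < \<alpha>" "\<alpha> < 1" for \<alpha>
  proof (rule INF_eqI)
    fix z
    assume "\<And>y. y \<in> Y \<Longrightarrow> z \<le> V_disc Y U f g \<alpha> y"
    from this[OF yd[OF \<alpha>]] show "z \<le> ereal ((1 - \<alpha>) * vd \<alpha>)"
      unfolding V_disc_minimizer(1)[OF opt_disc[OF \<alpha>] cost_disc[OF \<alpha>] \<alpha>(2)] .
  qed (rule V_disc_minimizer(2)[OF opt_disc[OF \<alpha>] cost_disc[OF \<alpha>] \<alpha>(2)])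
  have disc_le: "ereal ((1 - \<alpha>) * vd \<alpha>) \<le> ?L" if \<alpha>: "0 < \<alpha>" "\<alpha> < 1" for \<alpha>
  proof (rule le_g_star)
    fix \<gamma>
    assume \<gamma>: "\<gamma> \<in> W_set Y U f"
    show "(1 - \<alpha>) * vd \<alpha> \<le> (\<integral>p. ?h p \<partial>\<gamma>)"
    proof (rule discounted_cost_lower_bound_le_integral[OF \<gamma> h_bound h_cont \<alpha>])
      fix y u
      assume y: "y \<in> Y" and u: "u \<in> adm Y U f y"
      have bd: "\<bar>?h (traj f z v t, v t)\<bar> \<le> max \<bar>c\<bar> M" if "v \<in> adm Y U f z" for z v t
        using that h_bound by (simp add: adm_def)
      have "ereal (vd \<alpha>) = disc_cost f ?h \<alpha> (yd \<alpha>) (ud \<alpha>)"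
        unfolding cost_disc[OF \<alpha>, symmetric] disc_cost_def
        using g_le_M[OF D_d[OF conjI[OF \<alpha>]]] by (simp add: truncate_cost_def)
      also have "\<dots> \<le> disc_cost f ?h \<alpha> y u"
        using opt_d[OF conjI[OF \<alpha>]] y u unfolding optimal_disc_def by blast
      also have "\<dots> = ereal (\<Sum>t. \<alpha> ^ t * ?h (traj f y u t, u t))"
        by (rule disc_cost_bounded[OF \<alpha>]) (rule bd[OF u])
      finally show "vd \<alpha> \<le> (\<Sum>t. \<alpha> ^ t * ?h (traj f y u t, u t))"
        by simp
    qed
  qed

  have "\<exists>y u. optimal_fin Y U f ?h S y u \<and> (\<forall>t<S. (traj f y u t, u t) \<in> D)" if "S > 0" for S
    using assms(15)[OF M that] by blast
  then obtain yf uf where opt_f: "\<And>S. S > 0 \<Longrightarrow> optimal_fin Y U f ?h S (yf S) (uf S)"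
    and D_f: "\<And>S t. S > 0 \<Longrightarrow> t < S \<Longrightarrow> (traj f (yf S) (uf S) t, uf S t) \<in> D"
    by metis
  define xf where "xf S t = (traj f (yf S) (uf S) t, uf S t)" for S t
  define vf where "vf S = fin_cost f g S (yf S) (uf S) / real S" for S
  have fin_ne: "\<forall>y\<in>Y. adm_fin Y U f S y \<noteq> {}" for S
    using viable adm_subset_adm_fin by blast
  have opt_fin: "optimal_fin Y U f g S (yf S) (uf S)" if "S > 0" for S
    using optimal_fin_of_truncated[OF opt_f[OF that] g_le_M[OF D_f[OF that]]] by blast
  have yf: "yf S \<in> Y" if "S > 0" for S
    using opt_fin[OF that] by (simp add: optimal_fin_def)
  have V_fin_yf: "V_fin Y U f g S (yf S) = vf S" if "S > 0" for S
    unfolding vf_def by (rule V_fin_minimizer(1)[OF opt_fin[OF that] fin_ne])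
  have V_fin_ge: "vf S \<le> V_fin Y U f g S z" if "S > 0" "z \<in> Y" for S z
    unfolding vf_def by (rule V_fin_minimizer(2)[OF opt_fin[OF that(1)] fin_ne that(2)])
  have INF_fin: "(INF y\<in>Y. V_fin Y U f g S y) = vf S" if "S > 0" for S
    using V_fin_yf[OF that] V_fin_ge[OF that] yf[OF that]
    by (intro cInf_eq_minimum) (auto intro: rev_image_eqI)
  have fin_le: "ereal (vf S) \<le> ?L" if S: "S > 0" for S
  proof (rule le_g_star)
    fix \<gamma>
    assume \<gamma>: "\<gamma> \<in> W_set Y U f"
    have "fin_cost f g S (yf S) (uf S) \<le> (\<Sum>t<S. 1 ^ t) * (\<integral>p. ?h p \<partial>\<gamma>)"
    proof (rule process_cost_lower_bound_le_integral[OF \<gamma> h_bound h_cont])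
      fix y u
      assume y: "y \<in> Y" and u: "u \<in> adm_fin Y U f S y"
      have "fin_cost f g S (yf S) (uf S) = fin_cost f ?h S (yf S) (uf S)"
        unfolding fin_cost_def using g_le_M[OF D_f[OF S]]
        by (intro sum.cong) (auto simp: truncate_cost_def)
      also have "\<dots> \<le> fin_cost f ?h S y u"
        using opt_f[OF S] y u unfolding optimal_fin_def by blast
      finally show "fin_cost f g S (yf S) (uf S) \<le> (\<Sum>t<S. 1 ^ t * ?h (traj f y u t, u t))"
        by (simp add: fin_cost_def)
    qed simp_all
    then show "vf S \<le> (\<integral>p. ?h p \<partial>\<gamma>)"
      using S by (simp add: vf_def field_simps)
  qed

  \<comment> \<open>A bound for the values along a sequence of horizons \<open>s n \<rightarrow> \<infinity>\<close> is inherited by the cost of a stationary measure.\<close>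
  have fin_accumulation: "?L \<le> ereal a" if s: "\<And>n. n < s n" "\<And>n. vf (s n) \<le> a" for s :: "nat \<Rightarrow> nat" and a
  proof -
    have pos: "0 < s n" for n
      using s(1)[of n] by simp
    have xK: "xf (s n) t \<in> K" if "t < s n" for n t
      using D_f[OF pos that] K(3) by (auto simp: xf_def)
    have "\<exists>\<gamma>\<in>W_set Y U f. ext_integral \<gamma> g \<le> ereal a"
    proof (rule almost_invariant_family_imp_W[OF K(1,2) _ _ _ g_cont])
      show "xf (s n) t \<in> K" if "t \<in> set_pmf (pmf_of_set {..<s n})" for n t
        using that pos[of n] xK by (subst (asm) set_pmf_of_set) auto
      show "(\<lambda>n. 1 / real (Suc n)) \<longlonglongrightarrow> 0"
        by (rule LIMSEQ_Suc[OF lim_1_over_n])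
      show "\<bar>\<integral>t. \<phi> (f (xf (s n) t)) - \<phi> (fst (xf (s n) t)) \<partial>measure_pmf (pmf_of_set {..<s n})\<bar>
          \<le> 2 * b' * (1 / real (Suc n))"
        if \<phi>: "\<forall>p\<in>K. \<bar>\<phi> (fst p)\<bar> \<le> b' \<and> \<bar>\<phi> (f p)\<bar> \<le> b'" for n b' and \<phi> :: "real ^ 'm \<Rightarrow> real"
      proof -
        have "\<bar>\<phi> (fst (xf (s n) 0))\<bar> \<le> b'"
          using bspec[OF \<phi> xK[OF pos]] by blast
        then have "0 \<le> b'"
          by linarith
        have "\<bar>\<integral>t. \<phi> (f (xf (s n) t)) - \<phi> (fst (xf (s n) t)) \<partial>measure_pmf (pmf_of_set {..<s n})\<bar>
            \<le> 2 * b' * (1 / real (s n))"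
          unfolding xf_def
          by (rule occupation_fin_almost_invariant[OF pos _ \<phi>]) (rule xK[unfolded xf_def])
        also have "\<dots> \<le> 2 * b' * (1 / real (Suc n))"
          using s(1)[of n] \<open>0 \<le> b'\<close> by (intro mult_left_mono divide_left_mono) auto
        finally show ?thesis .
      qed
      show "(\<integral>t. g (xf (s n) t) \<partial>measure_pmf (pmf_of_set {..<s n})) \<le> a" for n
        using pos[of n] s(2)[of n]
        by (subst integral_pmf_of_set) (auto simp: vf_def fin_cost_def xf_def)
    qed
    then show ?thesis
      unfolding g_star_def by (elim bexE) (rule INF_lower2)
  qed
  \<comment> \<open>The same for discount factors; \<open>1 - 1 / (n + 2)\<close> rather than \<open>1 - 1 / (n + 1)\<close> keeps \<open>s n\<close> positive at \<open>n = 0\<close>.\<close>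
  have disc_accumulation: "?L \<le> ereal a"
    if s: "\<And>n. 1 - 1 / real (Suc (Suc n)) < s n" "\<And>n. s n < 1" "\<And>n. (1 - s n) * vd (s n) \<le> a"
    for s :: "nat \<Rightarrow> real" and a
  proof -
    have pos: "0 < s n" for n
    proof -
      have "0 < 1 - 1 / real (Suc (Suc n))"
        by simp
      with s(1)[of n] show ?thesis by linarith
    qed
    have xK: "xd (s n) t \<in> K" for n t
      using D_d[OF conjI[OF pos s(2)]] K(3) by (auto simp: xd_def)
    have "\<exists>\<gamma>\<in>W_set Y U f. ext_integral \<gamma> g \<le> ereal a"
    proof (rule almost_invariant_family_imp_W[OF K(1,2) _ _ _ g_cont])
      show "xd (s n) t \<in> K" for n t
        by (rule xK)
      show "(\<lambda>n. 1 / real (Suc (Suc n))) \<longlonglongrightarrow> 0"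
        by (rule LIMSEQ_Suc[OF LIMSEQ_Suc[OF lim_1_over_n]])
      show "\<bar>\<integral>t. \<phi> (f (xd (s n) t)) - \<phi> (fst (xd (s n) t)) \<partial>measure_pmf (geometric_pmf (1 - s n))\<bar>
          \<le> 2 * b' * (1 / real (Suc (Suc n)))"
        if \<phi>: "\<forall>p\<in>K. \<bar>\<phi> (fst p)\<bar> \<le> b' \<and> \<bar>\<phi> (f p)\<bar> \<le> b'" for n b' and \<phi> :: "real ^ 'm \<Rightarrow> real"
      proof -
        have "\<bar>\<phi> (fst (xd (s n) 0))\<bar> \<le> b'"
          using bspec[OF \<phi> xK] by blast
        then have "0 \<le> b'"
          by linarith
        have "\<bar>\<integral>t. \<phi> (f (xd (s n) t)) - \<phi> (fst (xd (s n) t)) \<partial>measure_pmf (geometric_pmf (1 - s n))\<bar>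
            \<le> 2 * b' * (1 - s n)"
          unfolding xd_def
          by (rule occupation_disc_almost_invariant[OF pos s(2) _ \<phi>]) (rule xK[unfolded xd_def])
        also have "\<dots> \<le> 2 * b' * (1 / real (Suc (Suc n)))"
          using s(1)[of n] \<open>0 \<le> b'\<close> by (intro mult_left_mono) auto
        finally show ?thesis .
      qed
      show "(\<integral>t. g (xd (s n) t) \<partial>measure_pmf (geometric_pmf (1 - s n))) \<le> a" for n
        using integral_geometric_pmf[OF pos s(2) b[OF xK]] s(3)[of n] by (simp add: vd_def)
    qed
    then show ?thesis
      unfolding g_star_def by (elim bexE) (rule INF_lower2)
  qed

  \<comment> \<open>The values are bounded by \<open>b\<close>, so some stationary measure has finite cost and \<open>g\<^sup>*\<close> is not infinite.\<close>
  have vf_le_b: "vf S \<le> b" if "S > 0" for S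
  proof -
    have "g (xf S t) \<le> b" if "t < S" for t
      using b[of "xf S t"] D_f[OF \<open>S > 0\<close> that] K(3) by (auto simp: xf_def abs_le_iff)
    then have "fin_cost f g S (yf S) (uf S) \<le> of_nat (card {..<S}) * b"
      unfolding fin_cost_def xf_def by (intro sum_bounded_above) auto
    then show ?thesis
      using that by (simp add: vf_def field_simps)
  qed
  have "?L \<le> ereal b"
    by (rule fin_accumulation[of Suc]) (auto intro: vf_le_b)
  moreover have "ereal (vf 1) \<le> ?L"
    by (rule fin_le) simp
  ultimately obtain l where l: "?L = ereal l"
    by (cases ?L) auto
  have "vf \<longlonglongrightarrow> l"
  proof (rule order_tendstoI)
    show "\<forall>\<^sub>F S in sequentially. vf S < a" if "l < a" for a
      using eventually_gt_at_top[of 0]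
    proof eventually_elim
      case (elim S)
      then have "vf S \<le> l"
        using fin_le[of S] by (simp add: l)
      with that show ?case by simp
    qed
    show "\<forall>\<^sub>F S in sequentially. a < vf S" if "a < l" for a
    proof (rule ccontr)
      assume "\<not> ?thesis"
      then have "\<forall>n. \<exists>S>n. vf S \<le> a"
        unfolding eventually_at_top_dense by (simp add: not_less)
      then obtain s where "\<And>n. n < s n" "\<And>n. vf (s n) \<le> a"
        by metis
      from fin_accumulation[OF this] that show False
        by (simp add: l)
    qed
  qed
  moreover have fin_eq: "\<forall>\<^sub>F S in sequentially. (INF y\<in>Y. V_fin Y U f g S y) = vf S"
    using eventually_gt_at_top[of 0] by eventually_elim (rule INF_fin)
  ultimately have lim_fin: "(\<lambda>S. INF y\<in>Y. V_fin Y U f g S y) \<longlonglongrightarrow> l"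
    by (simp add: tendsto_cong[OF fin_eq])
  have near_1: "\<forall>\<^sub>F \<alpha> in at_left (1::real). 0 < \<alpha> \<and> \<alpha> < 1"
    by (rule eventually_at_leftI[of 0]) auto
  have "((\<lambda>\<alpha>. (1 - \<alpha>) * vd \<alpha>) \<longlongrightarrow> l) (at_left 1)"
  proof (rule order_tendstoI)
    show "\<forall>\<^sub>F \<alpha> in at_left 1. (1 - \<alpha>) * vd \<alpha> < a" if "l < a" for a
      using near_1
    proof eventually_elim
      case (elim \<alpha>)
      then have "(1 - \<alpha>) * vd \<alpha> \<le> l"
        using disc_le[of \<alpha>] by (simp add: l)
      with that show ?case by simp
    qed
    show "\<forall>\<^sub>F \<alpha> in at_left 1. a < (1 - \<alpha>) * vd \<alpha>" if "a < l" for a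
    proof (rule ccontr)
      assume not: "\<not> ?thesis"
      have "\<exists>\<alpha>. 1 - 1 / real (Suc (Suc n)) < \<alpha> \<and> \<alpha> < 1 \<and> (1 - \<alpha>) * vd \<alpha> \<le> a" for n
      proof (rule ccontr)
        assume "\<not> ?thesis"
        then have "\<forall>\<^sub>F \<alpha> in at_left 1. a < (1 - \<alpha>) * vd \<alpha>"
          by (intro eventually_at_leftI[of "1 - 1 / real (Suc (Suc n))"]) (auto simp: not_le)
        with not show False by contradiction
      qed
      then obtain s where "\<And>n. 1 - 1 / real (Suc (Suc n)) < s n" "\<And>n. s n < 1"
        "\<And>n. (1 - s n) * vd (s n) \<le> a"
        by metis
      from disc_accumulation[OF this] that show False
        by (simp add: l)
    qed
  qed
  then have "((\<lambda>\<alpha>. ereal ((1 - \<alpha>) * vd \<alpha>)) \<longlongrightarrow> ereal l) (at_left 1)"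
    by simp
  moreover have disc_eq: "\<forall>\<^sub>F \<alpha> in at_left 1. (INF y\<in>Y. V_disc Y U f g \<alpha> y) = ereal ((1 - \<alpha>) * vd \<alpha>)"
    using near_1 by eventually_elim (rule INF_disc; simp)
  ultimately have lim_disc: "((\<lambda>\<alpha>. INF y\<in>Y. V_disc Y U f g \<alpha> y) \<longlongrightarrow> ereal l) (at_left 1)"
    by (simp add: tendsto_cong[OF disc_eq])
  have min_disc: "\<exists>y\<in>Y. \<forall>z\<in>Y. V_disc Y U f g \<alpha> y \<le> V_disc Y U f g \<alpha> z" if \<alpha>: "0 < \<alpha>" "\<alpha> < 1" for \<alpha>
    using yd[OF \<alpha>] V_disc_minimizer[OF opt_disc[OF \<alpha>] cost_disc[OF \<alpha>] \<alpha>(2)]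
    by (intro bexI[of _ "yd \<alpha>"]) simp_all
  have min_fin: "\<exists>y\<in>Y. \<forall>z\<in>Y. V_fin Y U f g S y \<le> V_fin Y U f g S z" if "S > 0" for S
    using yf[OF that] V_fin_yf[OF that] V_fin_ge[OF that] by (intro bexI[of _ "yf S"]) simp_all
  show ?thesis
  proof (intro conjI allI impI exI[of _ l])
    show "\<exists>y\<in>Y. \<forall>z\<in>Y. V_disc Y U f g \<alpha> y \<le> V_disc Y U f g \<alpha> z" if "0 < \<alpha> \<and> \<alpha> < 1" for \<alpha>
      using that by (intro min_disc) auto
  qed (rule min_fin l lim_disc lim_fin; assumption?)+
qed

end
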